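(* Let $I\subseteq S=\Bbbk[x_1,\dots,x_n]$ be a squarefree monomial ideal. Then $I$ is Gotzmann if and only if \[I=m_1(x_{i_{1,1}},\dots,x_{i_{1,r_1}})+m_1m_2(x_{i_{2,1}},\dots,x_{i_{2,r_2}})+\cdots+m_1\cdots m_s(x_{i_{s,1}},\dots,x_{i_{s,r_s}})\] for some squarefree monomials $m_1,\dots,m_s$ and variables $x_{i_{j,k}}$ such that all the $m_j$ and all the $x_{i_{j,k}}$ have pairwise disjoint supports.
   Context: Let $\Bbbk$ be a field and $S=\Bbbk[x_1,\dots,x_n]$, $\mathbf m=(x_1,\dots,x_n)$. A monomial ideal is squarefree if its minimal monomial generators are squarefree. For a homogeneous ideal $I$, $I_d$ is its degree-$d$ component, $|I_d|$ its $\Bbbk$-dimension, and $\mathbf m_1I_d$ the span of $\{x_jf: f\in I_d\}$. An ideal $I$ of $S$ is Gotzmann if for every $d$ and every homogeneous ideal $J\subseteq S$ with $|J_d|=|I_d|$ one has $|\mathbf m_1I_d|\le|\mathbf m_1J_d|$.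
   Formalization: The ideal I is assumed proper (I ≠ S): the unit ideal S is squarefree monomial and Gotzmann but is not of the displayed form, since every generator there has degree at least 1. *)

theory Defs
  imports Complex_Main "HOL-Library.Poly_Mapping"
begin

text \<open>Polynomials over a field 'k in the variables x_0, x_1, ... : finitely supported maps
  from exponent vectors (monomials, nat =>0 nat) to coefficients.
  The ring S = k[x_1..x_n] is the subset of polynomials involving only the variables
  with index < n.\<close>

type_synonym 'k mpoly = "(nat \<Rightarrow>\<^sub>0 nat) \<Rightarrow>\<^sub>0 'k"

definition mdeg :: "(nat \<Rightarrow>\<^sub>0 nat) \<Rightarrow> nat" where
  "mdeg u = (\<Sum>i\<in>Poly_Mapping.keys u. Poly_Mapping.lookup u i)"

definition polyS :: "nat \<Rightarrow> ('k::field) mpoly set" where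
  "polyS n = {p. \<forall>u\<in>Poly_Mapping.keys p. Poly_Mapping.keys u \<subseteq> {..<n}}"

definition monom :: "(nat \<Rightarrow>\<^sub>0 nat) \<Rightarrow> ('k::field) mpoly" where
  "monom u = Poly_Mapping.single u 1"

definition var :: "nat \<Rightarrow> ('k::field) mpoly" where
  "var i = monom (Poly_Mapping.single i 1)"

definition smul :: "'k::field \<Rightarrow> 'k mpoly \<Rightarrow> 'k mpoly" where
  "smul c p = Poly_Mapping.single 0 c * p"

definition kdim :: "('k::field) mpoly set \<Rightarrow> nat" where
  "kdim V = vector_space.dim smul V"

definition is_ideal :: "nat \<Rightarrow> ('k::field) mpoly set \<Rightarrow> bool" where
  "is_ideal n I \<longleftrightarrow> I \<subseteq> polyS n \<and> 0 \<in> I \<and> (\<forall>p\<in>I. \<forall>q\<in>I. p + q \<in> I)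
      \<and> (\<forall>f\<in>polyS n. \<forall>p\<in>I. f * p \<in> I)"

definition ideal_gen :: "nat \<Rightarrow> ('k::field) mpoly set \<Rightarrow> 'k mpoly set" where
  "ideal_gen n G = \<Inter>{J. is_ideal n J \<and> G \<subseteq> J}"

definition hcomp :: "nat \<Rightarrow> ('k::field) mpoly \<Rightarrow> 'k mpoly" where
  "hcomp d p = Abs_poly_mapping (\<lambda>u. if mdeg u = d then Poly_Mapping.lookup p u else 0)"

definition homog_ideal :: "nat \<Rightarrow> ('k::field) mpoly set \<Rightarrow> bool" where
  "homog_ideal n I \<longleftrightarrow> is_ideal n I \<and> (\<forall>p\<in>I. \<forall>d. hcomp d p \<in> I)"

definition comp :: "('k::field) mpoly set \<Rightarrow> nat \<Rightarrow> 'k mpoly set" where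
  "comp I d = {p \<in> I. \<forall>u\<in>Poly_Mapping.keys p. mdeg u = d}"

text \<open>generators of m_1 V (its k-span is m_1 V; kdim takes spans)\<close>
definition m1 :: "nat \<Rightarrow> ('k::field) mpoly set \<Rightarrow> 'k mpoly set" where
  "m1 n V = {var j * f | j f. j < n \<and> f \<in> V}"

definition gotzmann :: "nat \<Rightarrow> ('k::field) mpoly set \<Rightarrow> bool" where
  "gotzmann n I \<longleftrightarrow> (\<forall>d. \<forall>J::'k mpoly set. homog_ideal n J \<and> kdim (comp J d) = kdim (comp I d)
      \<longrightarrow> kdim (m1 n (comp I d)) \<le> kdim (m1 n (comp J d)))"

definition mdvd :: "(nat \<Rightarrow>\<^sub>0 nat) \<Rightarrow> (nat \<Rightarrow>\<^sub>0 nat) \<Rightarrow> bool" where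
  "mdvd v u \<longleftrightarrow> (\<forall>i. Poly_Mapping.lookup v i \<le> Poly_Mapping.lookup u i)"

definition sqfree_mon :: "(nat \<Rightarrow>\<^sub>0 nat) \<Rightarrow> bool" where
  "sqfree_mon u \<longleftrightarrow> (\<forall>i. Poly_Mapping.lookup u i \<le> 1)"

definition monomial_ideal :: "nat \<Rightarrow> ('k::field) mpoly set \<Rightarrow> bool" where
  "monomial_ideal n I \<longleftrightarrow> is_ideal n I \<and>
     (\<exists>G. (\<forall>u\<in>G. Poly_Mapping.keys u \<subseteq> {..<n}) \<and> I = ideal_gen n (monom ` G))"

definition min_mon_gen :: "nat \<Rightarrow> ('k::field) mpoly set \<Rightarrow> (nat \<Rightarrow>\<^sub>0 nat) \<Rightarrow> bool" where
  "min_mon_gen n I u \<longleftrightarrow> Poly_Mapping.keys u \<subseteq> {..<n} \<and> (monom u :: 'k mpoly) \<in> I \<and>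
     (\<forall>v. (monom v :: 'k mpoly) \<in> I \<and> mdvd v u \<longrightarrow> v = u)"

definition sqfree_monomial_ideal :: "nat \<Rightarrow> ('k::field) mpoly set \<Rightarrow> bool" where
  "sqfree_monomial_ideal n I \<longleftrightarrow> monomial_ideal n I \<and> (\<forall>u. min_mon_gen n I u \<longrightarrow> sqfree_mon u)"

end

theory Submission
  imports Defs
begin

text \<open>
  Passing to leading monomials, a monomial ideal is Gotzmann iff in every degree its monomials
  have an upper shadow as small as that of the lex segment of the same size; this is Macaulay's
  theorem, obtained here by compressing along each variable until the set is stable.

  An ideal has the displayed form iff it arises from \<open>0\<close> by steps \<open>I \<mapsto> x I\<close> and
  \<open>I \<mapsto> (x) + I\<close> with a new variable \<open>x\<close>.  These steps match the recursion for the growth of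
  lex segments, so such ideals are Gotzmann.  Conversely, equality in Macaulay's bound passes to
  the slices used in the compression, so deletion and link of a Gotzmann squarefree ideal at any
  variable are again Gotzmann, hence of the displayed form by induction on \<open>n\<close>.  If the ideal
  itself is not, then either \<open>n = 4\<close> and it is generated by edges of a graph containing a perfect
  matching, or it is \<open>x\<^sub>1(x\<^sub>2,\<dots>,x\<^sub>n) + (x\<^sub>2\<cdots>x\<^sub>n)\<close>; the growth in degree \<open>2\<close>,
  respectively \<open>n - 1\<close>, excludes both.
\<close>

section \<open>Monomials and lex segments\<close>

text \<open>A set compressed along every variable need not be a lex segment; it is only stable, and
  deducing even this takes a third variable that stays fixed while two others are exchanged. One and
  two variables are therefore counted by hand. For the converse, consider a nonzero ideal to which
  no step leads: it contains no variable and is divisible by none. The deletion at \<open>x\<close>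
  is nonzero and contains no variable, so, being of the displayed form, it is divisible by some
  \<open>y\<close>: every generator involves \<open>x\<close> or \<open>y\<close>. The link at
  \<open>x\<close> is divisible by no variable, so it contains some \<open>z\<close>: the quadric
  \<open>x z\<close> lies in the ideal. Two disjoint quadrics of this kind force n = 4, because each
  of their covers by two variables takes one variable from either quadric; if any two quadrics meet,
  the covers leave only the second obstruction.\<close>

abbreviation supp :: "(nat \<Rightarrow>\<^sub>0 nat) \<Rightarrow> nat set" where
  "supp \<equiv> Poly_Mapping.keys"

abbreviation expo :: "(nat \<Rightarrow>\<^sub>0 nat) \<Rightarrow> nat \<Rightarrow> nat" where
  "expo \<equiv> Poly_Mapping.lookup"

abbreviation X :: "nat \<Rightarrow> nat \<Rightarrow>\<^sub>0 nat" where
  "X i \<equiv> Poly_Mapping.single i (Suc 0)"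

lemma supp_add: "supp (u + v) = supp u \<union> supp v"
  by (auto simp: in_keys_iff lookup_add)

lemma expo_X: "expo (X i) j = (if i = j then 1 else 0)"
  by (simp add: lookup_single when_def)

lemma mdeg_superset:
  assumes "finite S" "supp u \<subseteq> S"
  shows "mdeg u = sum (expo u) S"
  unfolding mdeg_def
  by (rule sum.mono_neutral_left) (use assms in \<open>auto simp: in_keys_iff\<close>)

lemma mdeg_add: "mdeg (u + v) = mdeg u + mdeg v"
proof -
  let ?S = "supp u \<union> supp v"
  have "mdeg (u + v) = sum (expo (u + v)) ?S"
    by (rule mdeg_superset) (auto simp: supp_add)
  also have "\<dots> = sum (expo u) ?S + sum (expo v) ?S"
    by (simp add: lookup_add sum.distrib)
  also have "\<dots> = mdeg u + mdeg v"
    by (simp add: mdeg_superset[of ?S])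
  finally show ?thesis .
qed

lemma mdeg_single [simp]: "mdeg (Poly_Mapping.single i k) = k"
  by (simp add: mdeg_def)

lemma mdeg_zero [simp]: "mdeg 0 = 0"
  by (simp add: mdeg_def)

lemma mdeg_eq_0_iff: "mdeg u = 0 \<longleftrightarrow> u = 0"
  by (auto simp: mdeg_def in_keys_iff intro!: poly_mapping_eqI)

lemma expo_le_mdeg: "expo u i \<le> mdeg u"
proof (cases "i \<in> supp u")
  case True
  then show ?thesis unfolding mdeg_def by (intro member_le_sum) auto
next
  case False
  then show ?thesis by (simp add: in_keys_iff)
qed

lemma obtain_factor:
  assumes "i \<in> supp u"
  obtains w where "u = w + X i" "mdeg u = Suc (mdeg w)" "supp w \<subseteq> supp u"
proof
  show *: "u = (u - X i) + X i"
    using assms by (intro poly_mapping_eqI) (auto simp: lookup_add lookup_minus expo_X in_keys_iff)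
  show "mdeg u = Suc (mdeg (u - X i))"
    by (subst *) (simp only: mdeg_add mdeg_single)
  show "supp (u - X i) \<subseteq> supp u"
    by (auto simp: in_keys_iff lookup_minus)
qed

lemma obtain_slice:
  obtains w where "u = w + Poly_Mapping.single x (expo u x)" "x \<notin> supp w"
    "supp w \<subseteq> supp u" "mdeg u = mdeg w + expo u x"
proof
  let ?w = "u - Poly_Mapping.single x (expo u x)"
  show *: "u = ?w + Poly_Mapping.single x (expo u x)"
    by (intro poly_mapping_eqI) (auto simp: lookup_add lookup_minus lookup_single when_def)
  show "x \<notin> supp ?w" "supp ?w \<subseteq> supp u"
    by (auto simp: in_keys_iff lookup_minus lookup_single when_def)
  show "mdeg u = mdeg ?w + expo u x"
    by (subst *) (simp only: mdeg_add mdeg_single)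
qed

text \<open>Exponents are compared at the first index where they differ: this is the lexicographic
  order with variable 0 largest, so lex segments are up-sets.\<close>

lemma less_monomial_iff: "u < v \<longleftrightarrow> (\<exists>k. expo u k < expo v k \<and> (\<forall>j<k. expo u j = expo v j))"
  by (simp add: less_poly_mapping.rep_eq less_fun_def)

text \<open>By equality of degrees, the surplus of \<open>b\<close> at the first difference
  \<open>k\<close> must be compensated by a surplus of \<open>a\<close> at some later
  \<open>l\<close>.\<close>

lemma less_imp_later_exponent:
  assumes "a < b" "mdeg a = mdeg b"
  obtains k l where "k < l" "expo a k < expo b k" "\<forall>j<k. expo a j = expo b j" "expo b l < expo a l"
proof -
  obtain k where k: "expo a k < expo b k" "\<forall>j<k. expo a j = expo b j"
    using assms(1) less_monomial_iff by blast
  have "\<exists>l>k. expo b l < expo a l"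
  proof (rule ccontr)
    assume "\<not> ?thesis"
    then have le: "expo a j \<le> expo b j" for j
      using k by (metis linorder_neqE_nat not_le order.strict_implies_order order_refl)
    let ?S = "insert k (supp a \<union> supp b)"
    have "sum (expo a) ?S < sum (expo b) ?S"
      by (rule sum_strict_mono_ex1) (use le k in auto)
    then show False
      using assms(2) mdeg_superset[of ?S a] mdeg_superset[of ?S b] by (simp add: subset_insertI2)
  qed
  then show ?thesis using that k by blast
qed

text \<open>The later surplus of \<open>a\<close> at \<open>l\<close> gives
  \<open>k < l \<le> j\<close>, so multiplying \<open>a\<close> by \<open>X j\<close> leaves its
  exponents up to \<open>k\<close> alone, while \<open>X i\<close> can only raise those of
  \<open>b\<close>. This is what makes shadows of lex segments lex.\<close>

lemma mult_last_variable_less: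
  assumes "a < b" "mdeg a = mdeg b" "\<forall>l\<in>supp a. l \<le> j"
  shows "a + X j < b + X i"
proof -
  obtain k l where kl: "k < l" "expo a k < expo b k" "\<forall>j<k. expo a j = expo b j" "expo b l < expo a l"
    using less_imp_later_exponent[OF assms(1,2)] .
  have "l \<le> j" using kl(4) assms(3) by (auto simp: in_keys_iff)
  with kl(1) have "k < j" by simp
  show ?thesis
  proof (cases "i < k")
    case True
    with kl \<open>k < j\<close> show ?thesis unfolding less_monomial_iff
      by (intro exI[of _ i]) (auto simp: lookup_add expo_X)
  next
    case False
    with kl \<open>k < j\<close> show ?thesis unfolding less_monomial_iff
      by (intro exI[of _ k]) (auto simp: lookup_add expo_X)
  qed
qed

section \<open>Monomials of a fixed degree and their upper shadow\<close>

definition Mon :: "nat set \<Rightarrow> nat \<Rightarrow> (nat \<Rightarrow>\<^sub>0 nat) set" where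
  "Mon V d = {u. supp u \<subseteq> V \<and> mdeg u = d}"

definition shadow :: "nat set \<Rightarrow> (nat \<Rightarrow>\<^sub>0 nat) set \<Rightarrow> (nat \<Rightarrow>\<^sub>0 nat) set" where
  "shadow V M = {u + X i | u i. u \<in> M \<and> i \<in> V}"

lemma finite_Mon [simp]:
  assumes "finite V" shows "finite (Mon V d)"
proof (rule finite_imageD)
  show "inj_on expo (Mon V d)"
    by (rule inj_onI) (auto intro: poly_mapping_eqI)
  have "expo ` Mon V d \<subseteq> {f. \<forall>x. (x \<in> V \<longrightarrow> f x \<in> {..d}) \<and> (x \<notin> V \<longrightarrow> f x = 0)}"
    using expo_le_mdeg by (auto simp: Mon_def in_keys_iff)
  then show "finite (expo ` Mon V d)"
    by (rule finite_subset) (intro finite_set_of_finite_funs, use assms in auto)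
qed

lemma Mon_0 [simp]: "Mon V 0 = {0}"
  by (auto simp: Mon_def mdeg_eq_0_iff)

lemma Mon_empty_Suc [simp]: "Mon {} (Suc d) = {}"
  by (auto simp: Mon_def)

lemma Mon_add_X: "u \<in> Mon V d \<Longrightarrow> i \<in> V \<Longrightarrow> u + X i \<in> Mon V (Suc d)"
  by (auto simp: Mon_def supp_add mdeg_add)

lemma Mon_add_X_iff: "u + X i \<in> Mon V (Suc d) \<longleftrightarrow> u \<in> Mon V d \<and> i \<in> V"
  by (auto simp: Mon_def supp_add mdeg_add)

lemma Mon_mono: "V' \<subseteq> V \<Longrightarrow> Mon V' d \<subseteq> Mon V d"
  by (auto simp: Mon_def)

lemma shadow_subset: "M \<subseteq> Mon V d \<Longrightarrow> shadow V M \<subseteq> Mon V (Suc d)"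
  by (auto simp: shadow_def intro: Mon_add_X)

lemma shadow_mono: "M \<subseteq> M' \<Longrightarrow> shadow V M \<subseteq> shadow V M'"
  by (auto simp: shadow_def)

lemma shadow_empty [simp]: "shadow V {} = {}"
  by (auto simp: shadow_def)

lemma finite_shadow:
  assumes "finite V" "M \<subseteq> Mon V d"
  shows "finite (shadow V M)"
  using finite_subset[OF shadow_subset[OF assms(2)]] assms(1) by simp

lemma Mon_Suc_factor:
  assumes "u \<in> Mon V (Suc d)"
  obtains w i where "u = w + X i" "w \<in> Mon V d" "i \<in> V"
proof -
  have "supp u \<noteq> {}" using assms by (auto simp: Mon_def)
  then obtain i where i: "i \<in> supp u" by blast
  obtain w where "u = w + X i" using obtain_factor[OF i] by metis
  with assms show ?thesis using that by (metis Mon_add_X_iff)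
qed

lemma shadow_Mon: "shadow V (Mon V d) = Mon V (Suc d)"
  using shadow_subset[of "Mon V d" V d]
  by (auto simp: shadow_def elim!: Mon_Suc_factor)

section \<open>Lex segments and their shadows\<close>

definition lexseg :: "nat set \<Rightarrow> nat \<Rightarrow> (nat \<Rightarrow>\<^sub>0 nat) set \<Rightarrow> bool" where
  "lexseg V d L \<longleftrightarrow> L \<subseteq> Mon V d \<and> (\<forall>u\<in>L. \<forall>v\<in>Mon V d. u < v \<longrightarrow> v \<in> L)"

lemma lexseg_Mon: "lexseg V d (Mon V d)"
  by (auto simp: lexseg_def)

lemma lexsegD: "lexseg V d L \<Longrightarrow> u \<in> L \<Longrightarrow> v \<in> Mon V d \<Longrightarrow> u < v \<Longrightarrow> v \<in> L"
  unfolding lexseg_def by blast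

lemma lexseg_chain:
  assumes "lexseg V d L" "lexseg V d L'"
  shows "L \<subseteq> L' \<or> L' \<subseteq> L"
proof (rule ccontr)
  assume "\<not> ?thesis"
  then obtain u v where uv: "u \<in> L" "u \<notin> L'" "v \<in> L'" "v \<notin> L" by blast
  then have "u \<in> Mon V d" "v \<in> Mon V d" using assms by (auto simp: lexseg_def)
  with uv assms have "\<not> u < v" "\<not> v < u" by (auto simp: lexseg_def)
  then have "u = v" by simp
  with uv show False by simp
qed

text \<open>Removing the least monomial from a lex segment leaves a lex segment, so descent from
  \<open>Mon V d\<close> reaches every size.\<close>

lemma lexseg_exists:
  assumes "finite V" "c \<le> card (Mon V d)"
  shows "\<exists>L. lexseg V d L \<and> card L = c"
  using assms(2)
proof (induction "card (Mon V d) - c" arbitrary: c)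
  case 0
  then show ?case using lexseg_Mon[of V d] by auto
next
  case (Suc m)
  then obtain L where L: "lexseg V d L" "card L = Suc c"
    by (metis Suc_diff_Suc Suc_inject Suc_leI zero_less_Suc zero_less_diff)
  then have fin: "finite L" "L \<noteq> {}"
    by (auto intro: card_ge_0_finite)
  then have "card (L - {Min L}) = c" using L by simp
  moreover have "lexseg V d (L - {Min L})"
    using L fin unfolding lexseg_def by (auto simp: Min_less_iff) (metis Min_le leD)
  ultimately show ?case by blast
qed

definition lseg :: "nat set \<Rightarrow> nat \<Rightarrow> nat \<Rightarrow> (nat \<Rightarrow>\<^sub>0 nat) set" where
  "lseg V d c = (SOME L. lexseg V d L \<and> card L = c)"

lemma
  assumes "finite V" "c \<le> card (Mon V d)"
  shows lexseg_lseg: "lexseg V d (lseg V d c)" and card_lseg: "card (lseg V d c) = c"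
  using someI_ex[OF lexseg_exists[OF assms]] by (auto simp: lseg_def)

text \<open>The larger monomial \<open>v\<close> is divided by its last variable; if the quotient
  were outside \<open>L\<close> it would be below \<open>b\<close>, and
  \<open>mult_last_variable_less\<close> would put \<open>v\<close> below \<open>u\<close>.\<close>

lemma lexseg_shadow:
  assumes "lexseg V d L"
  shows "lexseg V (Suc d) (shadow V L)"
  unfolding lexseg_def
proof (intro conjI ballI impI)
  show "shadow V L \<subseteq> Mon V (Suc d)"
    using assms by (intro shadow_subset) (auto simp: lexseg_def)
next
  fix u v assume u: "u \<in> shadow V L" and v: "v \<in> Mon V (Suc d)" "u < v"
  from u obtain b i where b: "b \<in> L" "u = b + X i" "i \<in> V" by (auto simp: shadow_def)
  define j where "j = Max (supp v)"
  have ne: "supp v \<noteq> {}" using v by (auto simp: Mon_def)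
  then have j: "j \<in> supp v" by (simp add: j_def)
  obtain a where a: "v = a + X j" "supp a \<subseteq> supp v" using obtain_factor[OF j] by metis
  have aM: "a \<in> Mon V d" "j \<in> V" using v a Mon_add_X_iff by auto
  have bM: "b \<in> Mon V d" using b assms by (auto simp: lexseg_def)
  have "a \<in> L"
  proof (rule ccontr)
    assume "a \<notin> L"
    then have "a < b" using assms b aM unfolding lexseg_def by (metis linorder_neqE)
    moreover have "\<forall>l\<in>supp a. l \<le> j" using a(2) j_def by (auto intro: Max_ge)
    ultimately have "v < u" using mult_last_variable_less[of a b j i] aM bM a b by (auto simp: Mon_def)
    with v show False by simp
  qed
  with a aM show "v \<in> shadow V L" by (auto simp: shadow_def)
qed

section \<open>Counting monomials and the growth of lex segments\<close>

fun mon_count :: "nat \<Rightarrow> nat \<Rightarrow> nat" where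
  "mon_count 0 0 = 1"
| "mon_count 0 (Suc d) = 0"
| "mon_count (Suc n) 0 = 1"
| "mon_count (Suc n) (Suc d) = mon_count (Suc n) d + mon_count n (Suc d)"

text \<open>Size of the shadow of the lex segment of \<open>c\<close> monomials of degree
  \<open>d\<close> in \<open>n\<close> variables: Macaulay's bound, for the growth of ideals rather
  than of quotients. The threshold \<open>mon_count (Suc n) d\<close> is the number of monomials of
  degree \<open>d + 1\<close> divisible by the largest variable. In degree 0 only
  \<open>c \<le> 1\<close> is meaningful.\<close>

fun lex_growth :: "nat \<Rightarrow> nat \<Rightarrow> nat \<Rightarrow> nat" where
  "lex_growth 0 d c = 0"
| "lex_growth (Suc n) 0 c = (if c = 0 then 0 else Suc n)"
| "lex_growth (Suc n) (Suc d) c = (if c \<le> mon_count (Suc n) d then lex_growth (Suc n) d c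
     else mon_count (Suc n) (Suc d) + lex_growth n (Suc d) (c - mon_count (Suc n) d))"

lemma Mon_split:
  assumes "x \<in> V"
  shows "Mon V (Suc d) = (\<lambda>w. w + X x) ` Mon V d \<union> Mon (V - {x}) (Suc d)"
proof -
  have "u \<in> (\<lambda>w. w + X x) ` Mon V d" if "u \<in> Mon V (Suc d)" "u \<notin> Mon (V - {x}) (Suc d)" for u
  proof -
    from that have "x \<in> supp u" by (auto simp: Mon_def)
    then obtain w where "u = w + X x" using obtain_factor by metis
    with that show ?thesis by (auto simp: Mon_add_X_iff)
  qed
  moreover have "Mon (V - {x}) (Suc d) \<subseteq> Mon V (Suc d)" by (auto simp: Mon_def)
  ultimately show ?thesis using assms by (auto simp: Mon_add_X)
qed

lemma add_X_not_in_Mon: "w + X x \<notin> Mon (V - {x}) d"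
  by (auto simp: Mon_def supp_add)

lemma card_image_add [simp]: "card ((\<lambda>w. w + (t :: nat \<Rightarrow>\<^sub>0 nat)) ` A) = card A"
  by (intro card_image inj_onI) simp

lemma mon_count_0 [simp]: "mon_count n 0 = 1"
  by (cases n) auto

lemma card_Mon: "finite V \<Longrightarrow> card (Mon V d) = mon_count (card V) d"
proof (induction "card V" d arbitrary: V rule: mon_count.induct)
  case (4 n d)
  then obtain x where x: "x \<in> V" by fastforce
  then have n: "n = card (V - {x})" using 4 by simp
  have "card (Mon V (Suc d)) = card ((\<lambda>w. w + X x) ` Mon V d) + card (Mon (V - {x}) (Suc d))"
    unfolding Mon_split[OF x] using 4
    by (intro card_Un_disjoint) (auto simp: add_X_not_in_Mon)
  also have "\<dots> = mon_count (card V) d + mon_count n (Suc d)"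
    using 4(1)[OF 4(3)] 4(2)[OF n] 4 n by simp
  finally show ?case using 4(3) by (metis mon_count.simps(4))
qed auto

lemma lex_growth_0 [simp]: "lex_growth n d 0 = 0"
  by (induction n d "0::nat" rule: lex_growth.induct) auto

lemma shadow_image_add: "shadow V ((\<lambda>w. w + t) ` A) = (\<lambda>w. w + t) ` shadow V A"
  by (force simp: shadow_def image_iff algebra_simps)

text \<open>Products of \<open>B\<close> by \<open>x\<close> give nothing new, since all multiples
  of \<open>x\<close> of that degree are already present.\<close>

lemma shadow_split:
  assumes x: "x \<in> V" and B: "B \<subseteq> Mon (V - {x}) (Suc d)"
  shows "shadow V ((\<lambda>w. w + X x) ` Mon V d \<union> B) = (\<lambda>w. w + X x) ` Mon V (Suc d) \<union> shadow (V - {x}) B"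
proof -
  have "shadow V ((\<lambda>w. w + X x) ` Mon V d \<union> B)
      = shadow V ((\<lambda>w. w + X x) ` Mon V d) \<union> (\<lambda>w. w + X x) ` B \<union> shadow (V - {x}) B"
    using x by (auto simp: shadow_def)
  moreover have "(\<lambda>w. w + X x) ` B \<subseteq> (\<lambda>w. w + X x) ` Mon V (Suc d)"
    using B by (auto simp: Mon_def)
  ultimately show ?thesis by (auto simp: shadow_image_add shadow_Mon)
qed

lemma card_shadow_split:
  assumes "finite V" and x: "x \<in> V" and B: "B \<subseteq> Mon (V - {x}) (Suc d)"
  shows "card (shadow V ((\<lambda>w. w + X x) ` Mon V d \<union> B))
       = mon_count (card V) (Suc d) + card (shadow (V - {x}) B)"
proof -
  have "shadow (V - {x}) B \<subseteq> Mon (V - {x}) (Suc (Suc d))" by (rule shadow_subset[OF B])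
  then show ?thesis unfolding shadow_split[OF x B] using assms
    by (subst card_Un_disjoint) (auto simp: card_Mon finite_shadow[OF _ B] add_X_not_in_Mon)
qed

lemma card_split:
  assumes "finite V" and x: "x \<in> V" and B: "B \<subseteq> Mon (V - {x}) (Suc d)"
  shows "card ((\<lambda>w. w + X x) ` Mon V d \<union> B) = mon_count (card V) d + card B"
  using assms finite_subset[OF B]
  by (subst card_Un_disjoint) (auto simp: card_Mon add_X_not_in_Mon dest!: subsetD[OF B])

text \<open>All multiples of the largest variable \<open>x\<close> lie above the other monomials. A
  lex segment of positive degree therefore either is \<open>x\<close> times a lex segment of lower
  degree, or contains all multiples of \<open>x\<close> and continues with a lex segment in
  \<open>V - {x}\<close>: the two branches of \<open>lex_growth\<close>.\<close>

lemma card_shadow_lexseg: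
  assumes "finite V" "lexseg V d L"
  shows "card (shadow V L) = lex_growth (card V) d (card L)"
  using assms
proof (induction "card V" d "card L" arbitrary: V L rule: lex_growth.induct)
  case (1 d)
  then have "V = {}" by simp
  then show ?case by (simp add: shadow_def)
next
  case (2 n V L)
  then consider "L = {}" | "L = {0}" by (auto simp: lexseg_def)
  then show ?case
  proof cases
    case 2
    then have "shadow V L = X ` V" by (auto simp: shadow_def)
    moreover have "inj_on X V" by (auto simp: inj_on_def dest: arg_cong[of _ _ supp])
    ultimately show ?thesis using 2 \<open>Suc n = card V\<close>[symmetric] by (simp add: card_image)
  qed simp
next
  case (3 n d V L)
  \<comment> \<open>The smallest index is the largest variable.\<close>
  define x where "x = Min V"
  have V: "finite V" "V \<noteq> {}" using 3 by auto
  then have x: "x \<in> V" "\<And>y. y \<in> V \<Longrightarrow> x \<le> y" by (auto simp: x_def)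
  have cV: "card V = Suc n" and cVx: "card (V - {x}) = n" using 3 x by auto
  define B where "B = L \<inter> Mon (V - {x}) (Suc d)"
  define A where "A = {w \<in> Mon V d. w + X x \<in> L}"
  have LM: "L \<subseteq> Mon V (Suc d)" using 3 by (simp add: lexseg_def)
  have L: "L = (\<lambda>w. w + X x) ` A \<union> B"
    using LM Mon_split[OF x(1), of d] by (auto simp: A_def B_def)
  have less: "b < w + X x" if "b \<in> Mon (V - {x}) (Suc d)" "w \<in> Mon V d" for b w
  proof -
    have low: "j \<notin> V" if "j < x" for j using x(2)[of j] that by auto
    have "expo b x = 0" using that by (auto simp: Mon_def in_keys_iff)
    moreover have "expo b j = 0" "expo w j = 0" if "j < x" for j
      using low[OF that] \<open>b \<in> _\<close> \<open>w \<in> _\<close> by (auto simp: Mon_def in_keys_iff)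
    ultimately show ?thesis
      unfolding less_monomial_iff by (intro exI[of _ x]) (auto simp: lookup_add expo_X)
  qed
  have BM: "B \<subseteq> Mon (V - {x}) (Suc d)" by (auto simp: B_def)
  show ?case
  proof (cases "B = {}")
    case True
    then have L: "L = (\<lambda>w. w + X x) ` A" using L by simp
    have "lexseg V d A"
      unfolding lexseg_def A_def using x
      by (auto intro: lexsegD[OF 3(5)] Mon_add_X add_strict_right_mono)
    have "card A \<le> mon_count (card V) d"
      using card_mono[of "Mon V d" A] V by (auto simp: A_def card_Mon)
    then have le: "card L \<le> mon_count (Suc n) d" by (simp add: L cV)
    have "card (shadow V A) = lex_growth (card V) d (card A)"
      by (rule 3(1)) (use le L cV V \<open>lexseg V d A\<close> in auto)
    then show ?thesis using le by (simp add: cV L shadow_image_add)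
  next
    case False
    then have "A = Mon V d"
      using less x unfolding A_def B_def by (auto intro: lexsegD[OF 3(5)] Mon_add_X)
    then have L: "L = (\<lambda>w. w + X x) ` Mon V d \<union> B" using L by simp
    have c: "card L = mon_count (card V) d + card B"
      unfolding L using card_split[OF V(1) x(1) BM] by simp
    have "0 < card B" using False finite_subset[OF BM] V by (simp add: card_gt_0_iff)
    then have gt: "\<not> card L \<le> mon_count (Suc n) d" using c cV by simp
    have "lexseg (V - {x}) (Suc d) B"
      unfolding lexseg_def B_def using Mon_mono[of "V - {x}" V]
      by (auto intro: lexsegD[OF 3(5)])
    then have "card (shadow (V - {x}) B) = lex_growth (card (V - {x})) (Suc d) (card B)"
      by (intro 3(2)[OF gt]) (use cV cVx c V in auto)
    moreover have "card (shadow V L) = mon_count (card V) (Suc d) + card (shadow (V - {x}) B)"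
      unfolding L by (rule card_shadow_split[OF V(1) x(1) BM])
    ultimately show ?thesis using gt c by (simp add: cV cVx)
  qed
qed

lemma lex_growth_full: "lex_growth n d (mon_count n d) = mon_count n (Suc d)"
  using card_shadow_lexseg[OF _ lexseg_Mon, of "{..<n}" d] card_Mon[of "{..<n}"]
  by (simp add: shadow_Mon)

text \<open>At \<open>c = 0\<close> the recursion is still in its first branch;
  \<open>lex_growth_full\<close> shows that both branches agree there.\<close>

lemma lex_growth_add:
  "lex_growth (Suc n) (Suc d) (mon_count (Suc n) d + c) = mon_count (Suc n) (Suc d) + lex_growth n (Suc d) c"
  by (cases "c = 0") (simp_all add: lex_growth_full del: mon_count.simps)

text \<open>Multiplying a lex segment by the largest variable gives the lex segment of the same size
  one degree higher.\<close>

lemma lex_growth_Suc: "c \<le> mon_count n d \<Longrightarrow> lex_growth n (Suc d) c = lex_growth n d c"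
  by (cases n) auto

section \<open>Compression and Macaulay's theorem\<close>

definition slice :: "nat \<Rightarrow> nat \<Rightarrow> (nat \<Rightarrow>\<^sub>0 nat) set \<Rightarrow> (nat \<Rightarrow>\<^sub>0 nat) set" where
  "slice x k M = {w. x \<notin> supp w \<and> w + Poly_Mapping.single x k \<in> M}"

lemma expo_add_single_self: "x \<notin> supp w \<Longrightarrow> expo (w + Poly_Mapping.single x k) x = k"
  by (simp add: lookup_add in_keys_iff)

lemma Mon_add_single_iff:
  assumes "x \<in> V" "x \<notin> supp w"
  shows "w + Poly_Mapping.single x k \<in> Mon V d \<longleftrightarrow> k \<le> d \<and> w \<in> Mon (V - {x}) (d - k)"
  using assms by (auto simp: Mon_def supp_add mdeg_add split: if_splits)

lemma slice_subset:
  assumes "x \<in> V" "M \<subseteq> Mon V d"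
  shows "slice x k M \<subseteq> Mon (V - {x}) (d - k)"
  using assms Mon_add_single_iff by (auto simp: slice_def)

lemma slice_eq_empty:
  assumes "x \<in> V" "M \<subseteq> Mon V d" "d < k"
  shows "slice x k M = {}"
proof (rule ccontr)
  assume "slice x k M \<noteq> {}"
  then obtain w where "x \<notin> supp w" "w + Poly_Mapping.single x k \<in> Mon V d"
    using assms(2) by (auto simp: slice_def)
  then show False using Mon_add_single_iff[OF assms(1)] assms(3) by simp
qed

lemma image_slice: "(\<lambda>w. w + Poly_Mapping.single x k) ` slice x k M = {u \<in> M. expo u x = k}"
proof -
  have "u \<in> (\<lambda>w. w + Poly_Mapping.single x k) ` slice x k M" if u: "u \<in> M" "expo u x = k" for u
  proof -
    obtain w where "u = w + Poly_Mapping.single x (expo u x)" "x \<notin> supp w"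
      using obtain_slice by blast
    then have "w \<in> slice x k M" "u = w + Poly_Mapping.single x k" using u by (simp_all add: slice_def)
    then show ?thesis by blast
  qed
  then show ?thesis by (auto simp: slice_def expo_add_single_self)
qed

lemma sum_slices:
  assumes "finite V" "M \<subseteq> Mon V d"
  shows "(\<Sum>u\<in>M. h u) = (\<Sum>k\<le>d. \<Sum>w\<in>slice x k M. h (w + Poly_Mapping.single x k))"
proof -
  have fin: "finite M" using assms finite_subset finite_Mon by blast
  have "(\<lambda>u. expo u x) ` M \<subseteq> {..d}"
    using assms(2) expo_le_mdeg by (auto simp: Mon_def)
  then have "(\<Sum>u\<in>M. h u) = (\<Sum>k\<le>d. sum h {u \<in> M. expo u x = k})"
    using fin by (intro sum.group[symmetric]) auto
  also have "\<dots> = (\<Sum>k\<le>d. \<Sum>w\<in>slice x k M. h (w + Poly_Mapping.single x k))"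
    unfolding image_slice[symmetric] by (subst sum.reindex) (auto simp: inj_on_def)
  finally show ?thesis .
qed

lemma card_slices:
  assumes "finite V" "M \<subseteq> Mon V d"
  shows "card M = (\<Sum>k\<le>d. card (slice x k M))"
  using sum_slices[OF assms, of "\<lambda>_. 1::nat" x] by simp

lemma eq_if_slices_eq:
  assumes "M \<subseteq> Mon V d" "M' \<subseteq> Mon V d" "\<And>k. k \<le> d \<Longrightarrow> slice x k M = slice x k M'"
  shows "M = M'"
proof -
  have "N \<subseteq> N'" if "N \<subseteq> Mon V d" "\<And>k. k \<le> d \<Longrightarrow> slice x k N = slice x k N'" for N N'
  proof
    fix u assume u: "u \<in> N"
    then have "expo u x \<le> d" using that expo_le_mdeg[of u x] by (auto simp: Mon_def)
    then have "{v \<in> N. expo v x = expo u x} = {v \<in> N'. expo v x = expo u x}"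
      using that(2) by (simp add: image_slice[symmetric])
    then show "u \<in> N'" using u by blast
  qed
  then show ?thesis using assms by (intro equalityI) simp_all
qed

text \<open>The new factor is either another variable, which preserves the exponent \<open>k\<close>
  of \<open>x\<close>, or \<open>x\<close> itself, which raises it from \<open>k - 1\<close>. The
  overlap of these two contributions is where compression can save.\<close>

lemma slice_shadow:
  assumes "x \<in> V"
  shows "slice x k (shadow V M) = shadow (V - {x}) (slice x k M) \<union> (if k = 0 then {} else slice x (k - 1) M)"
    (is "?L = ?R")
proof
  show "?R \<subseteq> ?L"
  proof
    fix w assume "w \<in> ?R"
    then consider "w \<in> shadow (V - {x}) (slice x k M)" | "k \<noteq> 0" "w \<in> slice x (k - 1) M"
      by (auto split: if_splits)
    then show "w \<in> ?L"
    proof cases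
      case 1
      then obtain v i where "w = v + X i" "i \<in> V" "i \<noteq> x" "x \<notin> supp v" "v + Poly_Mapping.single x k \<in> M"
        by (auto simp: shadow_def slice_def)
      then show ?thesis
        unfolding slice_def shadow_def
        by (auto simp: supp_add intro!: exI[of _ "v + Poly_Mapping.single x k"] exI[of _ i] simp: ac_simps)
    next
      case 2
      then obtain j where "k = Suc j" by (cases k) auto
      with 2 assms show ?thesis
        unfolding slice_def shadow_def
        by (auto intro!: exI[of _ "w + Poly_Mapping.single x j"] exI[of _ x] simp: add.assoc single_add[symmetric])
    qed
  qed
next
  show "?L \<subseteq> ?R"
  proof
    fix w assume "w \<in> ?L"
    then obtain u i where u: "x \<notin> supp w" "w + Poly_Mapping.single x k = u + X i" "u \<in> M" "i \<in> V"
      by (auto simp: slice_def shadow_def)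
    show "w \<in> ?R"
    proof (cases "i = x")
      case True
      have "expo (w + Poly_Mapping.single x k) x = expo (u + X x) x" using u True by simp
      then have k: "k = Suc (expo u x)" using u(1) by (simp add: lookup_add in_keys_iff)
      have "w + Poly_Mapping.single x (expo u x) + X x = u + X x"
        using u(2) True k by (simp add: add.assoc single_add[symmetric])
      then have "w + Poly_Mapping.single x (expo u x) = u" by simp
      then show ?thesis using u k by (simp add: slice_def)
    next
      case False
      have "i \<in> supp (w + Poly_Mapping.single x k)" using u(2) by (simp add: supp_add)
      then have "i \<in> supp w" using False by (auto simp: supp_add split: if_splits)
      then obtain v where v: "w = v + X i" "supp v \<subseteq> supp w" using obtain_factor by metis
      then have "v + Poly_Mapping.single x k + X i = u + X i" using u(2) by (simp add: ac_simps)
      then have "v + Poly_Mapping.single x k = u" by simp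
      then have "v \<in> slice x k M" using u v by (auto simp: slice_def)
      then show ?thesis using v False u(4) by (auto simp: shadow_def)
    qed
  qed
qed

lemma card_Un_chain:
  assumes "finite A" "finite B" "A \<subseteq> B \<or> B \<subseteq> A"
  shows "card (A \<union> B) = max (card A) (card B)"
  using assms(3)
proof
  assume "A \<subseteq> B"
  then show ?thesis using card_mono[OF assms(2)] by (simp add: Un_absorb1 max_absorb2)
next
  assume "B \<subseteq> A"
  then show ?thesis using card_mono[OF assms(1)] by (simp add: Un_absorb2 max_absorb1)
qed

section \<open>Compression along one variable\<close>

definition compress :: "nat set \<Rightarrow> nat \<Rightarrow> nat \<Rightarrow> (nat \<Rightarrow>\<^sub>0 nat) set \<Rightarrow> (nat \<Rightarrow>\<^sub>0 nat) set" where
  "compress V d x M = {w + Poly_Mapping.single x k | w k.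
     k \<le> d \<and> w \<in> lseg (V - {x}) (d - k) (card (slice x k M))}"

context
  fixes V :: "nat set" and d x :: nat and M :: "(nat \<Rightarrow>\<^sub>0 nat) set"
  assumes V: "finite V" and x: "x \<in> V" and M: "M \<subseteq> Mon V d"
begin

lemma card_slice_le: "card (slice x k M) \<le> card (Mon (V - {x}) (d - k))"
  using slice_subset[OF x M] V by (intro card_mono) auto

lemma lexseg_lseg_slice: "lexseg (V - {x}) (d - k) (lseg (V - {x}) (d - k) (card (slice x k M)))"
  using V card_slice_le by (intro lexseg_lseg) auto

lemma card_lseg_slice: "card (lseg (V - {x}) (d - k) (card (slice x k M))) = card (slice x k M)"
  using V card_slice_le by (intro card_lseg) auto

lemma lseg_slice_subset: "lseg (V - {x}) (d - k) (card (slice x k M)) \<subseteq> Mon (V - {x}) (d - k)"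
  using lexseg_lseg_slice by (simp add: lexseg_def)

lemma slice_compress:
  assumes "k \<le> d"
  shows "slice x k (compress V d x M) = lseg (V - {x}) (d - k) (card (slice x k M))"
proof -
  have nx: "x \<notin> supp w" if "w \<in> lseg (V - {x}) (d - j) (card (slice x j M))" for w j
    using lseg_slice_subset[of j] that by (auto simp: Mon_def)
  have "w \<in> lseg (V - {x}) (d - k) (card (slice x k M))" if w: "w \<in> slice x k (compress V d x M)" for w
  proof -
    obtain v j where v: "w + Poly_Mapping.single x k = v + Poly_Mapping.single x j" "x \<notin> supp w"
      "v \<in> lseg (V - {x}) (d - j) (card (slice x j M))"
      using w by (auto simp: slice_def compress_def)
    have "k = j"
      using expo_add_single_self[OF v(2), of k] expo_add_single_self[OF nx[OF v(3)], of j] v(1) by metis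
    then show ?thesis using v by simp
  qed
  moreover have "w \<in> slice x k (compress V d x M)" if "w \<in> lseg (V - {x}) (d - k) (card (slice x k M))" for w
  proof -
    have "w + Poly_Mapping.single x k \<in> compress V d x M"
      unfolding compress_def using that assms by blast
    then show ?thesis using nx[OF that] by (simp add: slice_def)
  qed
  ultimately show ?thesis by blast
qed

lemma compress_subset: "compress V d x M \<subseteq> Mon V d"
proof
  fix u assume "u \<in> compress V d x M"
  then obtain w k where "u = w + Poly_Mapping.single x k" "k \<le> d" "w \<in> Mon (V - {x}) (d - k)"
    using lseg_slice_subset by (auto simp: compress_def)
  then show "u \<in> Mon V d" using x by (auto simp: Mon_add_single_iff Mon_def supp_add mdeg_add split: if_splits)
qed

lemma card_compress: "card (compress V d x M) = card M"
  unfolding card_slices[OF V compress_subset, of x] card_slices[OF V M, of x]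
  by (intro sum.cong) (auto simp: slice_compress card_lseg_slice)

text \<open>After compression the two contributions in \<open>slice_shadow\<close> are lex segments
  of the same degree, hence nested, and their union has the size of the larger one.\<close>

definition slice_bound :: "nat \<Rightarrow> nat" where
  "slice_bound k = max (lex_growth (card V - 1) (d - k) (card (slice x k M)))
     (if k = 0 then 0 else card (slice x (k - 1) M))"

lemma card_Vx: "card (V - {x}) = card V - 1"
  using V x by simp

lemma card_slice_shadow_compress:
  assumes "k \<le> Suc d"
  shows "card (slice x k (shadow V (compress V d x M))) = slice_bound k"
proof (cases k)
  case 0
  then show ?thesis
    using card_shadow_lexseg[OF _ lexseg_lseg_slice, of 0] V
    by (simp add: slice_shadow[OF x] slice_compress card_lseg_slice[of 0, simplified] card_Vx slice_bound_def)
next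
  case (Suc j)
  let ?L = "\<lambda>k. lseg (V - {x}) (d - k) (card (slice x k M))"
  show ?thesis
  \<comment> \<open>In the top slice \<open>M\<close> itself has nothing, and the truncated
    \<open>d - k\<close> would give the wrong degree; only the products by \<open>x\<close> from
    slice \<open>d\<close> remain.\<close>
  proof (cases "k = Suc d")
    case True
    then show ?thesis using slice_eq_empty[OF x M] slice_eq_empty[OF x compress_subset] Suc
      card_lseg_slice[of d]
      by (simp add: slice_shadow[OF x] slice_compress slice_bound_def)
  next
    case False
    with assms Suc have k: "k \<le> d" "d - j = Suc (d - k)" by auto
    have l1: "lexseg (V - {x}) (d - j) (shadow (V - {x}) (?L k))"
      unfolding k(2) by (rule lexseg_shadow[OF lexseg_lseg_slice])
    have l2: "lexseg (V - {x}) (d - j) (?L j)" by (rule lexseg_lseg_slice)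
    have eq: "slice x k (shadow V (compress V d x M)) = shadow (V - {x}) (?L k) \<union> ?L j"
      using k Suc by (simp add: slice_shadow[OF x] slice_compress)
    have fin: "finite (shadow (V - {x}) (?L k))" "finite (?L j)"
      using l1 l2 V finite_subset[OF _ finite_Mon[of "V - {x}"]] by (auto simp: lexseg_def)
    have "card (shadow (V - {x}) (?L k) \<union> ?L j) = max (card (shadow (V - {x}) (?L k))) (card (?L j))"
      by (rule card_Un_chain[OF fin lexseg_chain[OF l1 l2]])
    also have "card (shadow (V - {x}) (?L k)) = lex_growth (card V - 1) (d - k) (card (slice x k M))"
      using card_shadow_lexseg[OF _ lexseg_lseg_slice, of k] V by (simp add: card_lseg_slice card_Vx)
    finally show ?thesis unfolding eq using Suc by (simp add: slice_bound_def card_lseg_slice)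
  qed
qed

lemma card_shadow_compress: "card (shadow V (compress V d x M)) = (\<Sum>k\<le>Suc d. slice_bound k)"
  unfolding card_slices[OF V shadow_subset[OF compress_subset], of x]
  by (intro sum.cong) (auto simp: card_slice_shadow_compress)

text \<open>Each part of the union in \<open>slice_shadow\<close> is bounded on its own. The bound
  in fewer variables is an assumption because the lemma serves twice: inside the induction for
  \<open>macaulay\<close>, and afterwards with \<open>macaulay\<close> itself when equality is
  analysed.\<close>

lemma slice_bound_le:
  assumes IH: "\<And>e N. N \<subseteq> Mon (V - {x}) e \<Longrightarrow> lex_growth (card V - 1) e (card N) \<le> card (shadow (V - {x}) N)"
  shows "slice_bound k \<le> card (slice x k (shadow V M))"
proof -
  have "lex_growth (card V - 1) (d - k) (card (slice x k M)) \<le> card (shadow (V - {x}) (slice x k M))"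
    by (rule IH[OF slice_subset[OF x M]])
  moreover have fin: "finite (shadow (V - {x}) (slice x k M))"
    using V by (intro finite_shadow[OF _ slice_subset[OF x M]]) auto
  moreover have fin': "finite (slice x j M)" for j
    using slice_subset[OF x M] V finite_subset by (metis finite_Diff finite_Mon)
  moreover have "card A \<le> card (A \<union> B)" "card B \<le> card (A \<union> B)" if "finite A" "finite B"
    for A B :: "(nat \<Rightarrow>\<^sub>0 nat) set" using that by (auto intro!: card_mono)
  ultimately show ?thesis
    unfolding slice_bound_def slice_shadow[OF x] by (auto intro: order_trans)
qed

end

text \<open>Exchange argument: any bijection from \<open>L - A\<close> to \<open>A - L\<close> moves
  every element down, since \<open>L\<close> is an up-set, and so raises \<open>r\<close>.\<close>

lemma sum_upclosed_less:
  fixes r :: "'a::linorder \<Rightarrow> nat"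
  assumes fin: "finite S" and "A \<subseteq> S" "L \<subseteq> S" "card A = card L" "A \<noteq> L"
    and up: "\<And>u v. u \<in> L \<Longrightarrow> v \<in> S \<Longrightarrow> u < v \<Longrightarrow> v \<in> L"
    and r: "\<And>u v. u \<in> S \<Longrightarrow> v \<in> S \<Longrightarrow> u < v \<Longrightarrow> r v < r u"
  shows "sum r L < sum r A"
proof -
  have finAL: "finite A" "finite L" using assms(2,3) finite_subset[OF _ fin] by blast+
  have c: "card (L - A) = card (A - L)"
    using finAL assms(4) by (simp add: card_Diff_subset_Int Int_commute)
  then obtain h where h: "bij_betw h (L - A) (A - L)"
    using finite_same_card_bij[of "L - A" "A - L"] finAL by blast
  have ne: "L - A \<noteq> {}"
    using card_subset_eq[OF finAL(1), of L] assms(4,5) by auto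
  have "sum r (L - A) < (\<Sum>u\<in>L - A. r (h u))"
  proof (rule sum_strict_mono)
    fix u assume u: "u \<in> L - A"
    then have hu: "h u \<in> A - L" using h by (auto simp: bij_betw_def)
    then have "h u \<noteq> u" "\<not> u < h u" using up[of u "h u"] u assms(2) by auto
    then have "h u < u" by simp
    then show "r u < r (h u)" using r[of "h u" u] hu u assms(2,3) by auto
  qed (use finAL ne in auto)
  also have "\<dots> = sum r (A - L)" by (rule sum.reindex_bij_betw[OF h])
  finally have "sum r (L - A) < sum r (A - L)" .
  moreover have "sum r L = sum r (L - A) + sum r (L \<inter> A)" "sum r A = sum r (A - L) + sum r (L \<inter> A)"
    using sum.Int_Diff[OF finAL(2), of r A] sum.Int_Diff[OF finAL(1), of r L]
    by (simp_all add: Int_commute)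
  ultimately show ?thesis by simp
qed

text \<open>Position counted from the top, 0 for the largest monomial. Its sum over a set is the
  measure by which repeated compression terminates.\<close>

definition lex_rank :: "nat set \<Rightarrow> nat \<Rightarrow> (nat \<Rightarrow>\<^sub>0 nat) \<Rightarrow> nat" where
  "lex_rank V d u = card {v \<in> Mon V d. u < v}"

lemma lex_rank_less:
  assumes "finite V" "v \<in> Mon V d" "u < v"
  shows "lex_rank V d v < lex_rank V d u"
  unfolding lex_rank_def by (rule psubset_card_mono) (use assms in auto)

text \<open>Adding the exponent \<open>k\<close> at \<open>x\<close> preserves the order, so
  \<open>sum_upclosed_less\<close> applies within each slice that changes, and some slice
  changes.\<close>

lemma lex_rank_compress:
  assumes V: "finite V" and x: "x \<in> V" and M: "M \<subseteq> Mon V d" and ne: "compress V d x M \<noteq> M"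
  shows "sum (lex_rank V d) (compress V d x M) < sum (lex_rank V d) M"
proof -
  note C = compress_subset[OF V x M]
  have less: "(\<Sum>w\<in>slice x k (compress V d x M). lex_rank V d (w + Poly_Mapping.single x k))
       < (\<Sum>w\<in>slice x k M. lex_rank V d (w + Poly_Mapping.single x k))"
    if k: "k \<le> d" "slice x k (compress V d x M) \<noteq> slice x k M" for k
  proof (rule sum_upclosed_less[of "Mon (V - {x}) (d - k)"])
    show "slice x k M \<subseteq> Mon (V - {x}) (d - k)" "slice x k (compress V d x M) \<subseteq> Mon (V - {x}) (d - k)"
      by (rule slice_subset[OF x M], rule slice_subset[OF x C])
    show "card (slice x k M) = card (slice x k (compress V d x M))"
      using k by (simp add: slice_compress[OF V x M] card_lseg_slice[OF V x M])
    show "v \<in> slice x k (compress V d x M)"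
      if "u \<in> slice x k (compress V d x M)" "v \<in> Mon (V - {x}) (d - k)" "u < v" for u v
      using that k lexsegD[OF lexseg_lseg_slice[OF V x M]] by (auto simp: slice_compress[OF V x M])
    show "lex_rank V d (v + Poly_Mapping.single x k) < lex_rank V d (u + Poly_Mapping.single x k)"
      if uv: "u \<in> Mon (V - {x}) (d - k)" "v \<in> Mon (V - {x}) (d - k)" "u < v" for u v
    proof (rule lex_rank_less[OF V])
      have "x \<notin> supp v" using uv by (auto simp: Mon_def)
      then show "v + Poly_Mapping.single x k \<in> Mon V d" using Mon_add_single_iff[OF x] uv k by auto
      show "u + Poly_Mapping.single x k < v + Poly_Mapping.single x k"
        using uv by (intro add_strict_right_mono)
    qed
  qed (use V k in auto)
  have le: "(\<Sum>w\<in>slice x k (compress V d x M). lex_rank V d (w + Poly_Mapping.single x k))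
       \<le> (\<Sum>w\<in>slice x k M. lex_rank V d (w + Poly_Mapping.single x k))" if "k \<le> d" for k
    using less[OF that] by (cases "slice x k (compress V d x M) = slice x k M") (auto intro: less_imp_le)
  obtain k where "k \<le> d" "slice x k (compress V d x M) \<noteq> slice x k M"
    using eq_if_slices_eq[OF C M] ne by blast
  then show ?thesis
    unfolding sum_slices[OF V C, of _ x] sum_slices[OF V M, of _ x]
    by (intro sum_strict_mono_ex1) (use le less in auto)
qed

text \<open>Weaker than strong stability: only the single variable \<open>z\<close> is exchanged, in
  use always the last one.\<close>

definition stable :: "nat set \<Rightarrow> nat \<Rightarrow> (nat \<Rightarrow>\<^sub>0 nat) set \<Rightarrow> bool" where
  "stable V z M \<longleftrightarrow> (\<forall>t. \<forall>i\<in>V. t + X z \<in> M \<longrightarrow> t + X i \<in> M)"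

lemma X_less: "i < j \<Longrightarrow> X j < X i"
  unfolding less_monomial_iff by (intro exI[of _ i]) (auto simp: expo_X)

lemma stable_lexseg:
  assumes "lexseg V d L" "z \<in> V" "\<And>i. i \<in> V \<Longrightarrow> i \<le> z"
  shows "stable V z L"
  unfolding stable_def
proof (intro allI ballI impI)
  fix t i assume i: "i \<in> V" and t: "t + X z \<in> L"
  show "t + X i \<in> L"
  proof (cases "i = z")
    case False
    then have "t + X z < t + X i"
      using assms(3)[OF i] by (intro add_strict_left_mono X_less) auto
    moreover have "t + X i \<in> Mon V d"
    proof -
      have "t + X z \<in> Mon V d" using t assms(1) by (auto simp: lexseg_def)
      then show ?thesis using i by (auto simp: Mon_def supp_add mdeg_add)
    qed
    ultimately show ?thesis using lexsegD[OF assms(1) t] by blast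
  qed (use t in simp)
qed

text \<open>Trading one \<open>z\<close> for \<open>i\<close> shows that a product by
  \<open>i\<close> in slice \<open>k + 1\<close> already occurs in slice \<open>k\<close>. In
  positive \<open>z\<close>-exponents the shadow thus consists of the multiples by \<open>z\<close>,
  as many as \<open>M\<close> has elements; the rest is the shadow of the \<open>z\<close>-free
  part.\<close>

lemma card_shadow_stable:
  assumes V: "finite V" and z: "z \<in> V" and M: "M \<subseteq> Mon V d" and st: "stable V z M"
  shows "card (shadow V M) = card (shadow (V - {z}) (slice z 0 M)) + card M"
proof -
  have sub: "shadow (V - {z}) (slice z (Suc k) M) \<subseteq> slice z k M" for k
  proof
    fix w assume "w \<in> shadow (V - {z}) (slice z (Suc k) M)"
    then obtain v i where v: "w = v + X i" "i \<in> V" "i \<noteq> z" "z \<notin> supp v"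
      "v + Poly_Mapping.single z (Suc k) \<in> M"
      by (auto simp: shadow_def slice_def)
    then have "v + Poly_Mapping.single z k + X z \<in> M" by (simp add: add.assoc single_add[symmetric])
    then have "v + Poly_Mapping.single z k + X i \<in> M" using st v unfolding stable_def by blast
    then show "w \<in> slice z k M" using v by (auto simp: slice_def supp_add ac_simps)
  qed
  have "card (shadow V M) = (\<Sum>k\<le>Suc d. card (slice z k (shadow V M)))"
    by (rule card_slices[OF V shadow_subset[OF M]])
  also have "\<dots> = card (slice z 0 (shadow V M)) + (\<Sum>k\<le>d. card (slice z (Suc k) (shadow V M)))"
    by (rule sum.atMost_Suc_shift)
  also have "(\<Sum>k\<le>d. card (slice z (Suc k) (shadow V M))) = (\<Sum>k\<le>d. card (slice z k M))"
    using sub by (intro sum.cong) (auto simp: slice_shadow[OF z] Un_absorb1)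
  also have "\<dots> = card M" by (rule card_slices[OF V M, symmetric])
  finally show ?thesis by (simp add: slice_shadow[OF z])
qed

text \<open>Replacing the last variable \<open>z\<close> by the last but one raises a monomial in the order without
  passing any \<open>z\<close>-free monomial.  Hence a \<open>z\<close>-free monomial missing from a stable set lies below
  the whole set.\<close>

lemma stable_slice_0:
  assumes V: "finite V" "z \<in> V" "y \<in> V" "y < z" "\<And>i. i \<in> V \<Longrightarrow> i \<noteq> z \<Longrightarrow> i \<le> y"
    and L: "lexseg V d L" and M: "M \<subseteq> Mon V d" "stable V z M" "lexseg (V - {z}) d (slice z 0 M)"
    and c: "card L = card M"
  shows "slice z 0 L \<subseteq> slice z 0 M"
proof (rule ccontr)
  assume "\<not> ?thesis"
  then obtain b where b: "b \<in> L" "b \<notin> M" "z \<notin> supp b" by (auto simp: slice_def)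
  then have bM: "b \<in> Mon V d" using L by (auto simp: lexseg_def)
  have gt: "u \<in> M \<Longrightarrow> b < u" for u
  proof (induction "expo u z" arbitrary: u)
    case 0
    then have u: "u \<in> slice z 0 M" by (simp add: slice_def in_keys_iff)
    have "b \<in> Mon (V - {z}) d" using bM b by (auto simp: Mon_def)
    then have "\<not> u < b" using lexsegD[OF M(3) u] b by (auto simp: slice_def)
    moreover have "u \<noteq> b" using 0 b by auto
    ultimately show ?case by simp
  next
    case (Suc m)
    then have "z \<in> supp u" by (simp add: in_keys_iff)
    then obtain t where t: "u = t + X z" using obtain_factor by metis
    have vM: "t + X y \<in> M" using M(2) Suc.prems V t unfolding stable_def by blast
    moreover have "m = expo (t + X y) z" using Suc.hyps(2) t V(4) by (simp add: lookup_add expo_X)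
    ultimately have "b < t + X y" using Suc.hyps(1) by blast
    moreover have "mdeg b = mdeg (t + X y)" using vM M(1) bM by (auto simp: Mon_def)
    ultimately obtain k l where kl: "k < l" "expo b k < expo (t + X y) k"
      "\<forall>j<k. expo b j = expo (t + X y) j" "expo (t + X y) l < expo b l"
      using less_imp_later_exponent by blast
    \<comment> \<open>The compensating index \<open>l\<close> is not \<open>z\<close>, since
      \<open>b\<close> is \<open>z\<close>-free, so \<open>k < l \<le> y\<close>: the exchange of
      \<open>y\<close> and \<open>z\<close> happens beyond the first difference.\<close>
    then have "l \<in> V - {z}" using bM b(3) by (auto simp: Mon_def in_keys_iff)
    then have "k < y" using V(5)[of l] kl(1) by auto
    then show ?case
      unfolding less_monomial_iff t using kl V(4) by (intro exI[of _ k]) (auto simp: lookup_add expo_X)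
  qed
  have "M \<subseteq> L" using gt lexsegD[OF L b(1)] M(1) by auto
  then have "M \<subset> L" using b by blast
  moreover have "finite L" using L finite_subset[OF _ finite_Mon[OF V(1)]] by (auto simp: lexseg_def)
  ultimately show False using c psubset_card_mono by (metis less_irrefl)
qed

text \<open>\<open>z\<close> is exchanged for \<open>i\<close> inside a slice of a third variable
  \<open>x\<close>: this slice is a lex segment by compression, and \<open>w + X i\<close> lies
  above \<open>w + X z\<close>.\<close>

lemma stable_if_compressed:
  assumes V: "finite V" "z \<in> V" "\<And>i. i \<in> V \<Longrightarrow> i \<le> z" "3 \<le> card V" and M: "M \<subseteq> Mon V d"
    and C: "\<And>x. x \<in> V \<Longrightarrow> compress V d x M = M"
  shows "stable V z M"
  unfolding stable_def
proof (intro allI ballI impI)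
  fix t i assume i: "i \<in> V" and t: "t + X z \<in> M"
  show "t + X i \<in> M"
  proof (cases "i = z")
    case False
    have "V - {i, z} \<noteq> {}"
    proof
      assume "V - {i, z} = {}"
      then have "card V \<le> card {i, z}" by (intro card_mono) auto
      also have "\<dots> \<le> 2" using card_insert_le_m1[of 2 "{z}" i] by simp
      finally show False using V(4) by simp
    qed
    then obtain x where x: "x \<in> V" "x \<noteq> i" "x \<noteq> z" by blast
    define k where "k = expo t x"
    obtain w where w: "t = w + Poly_Mapping.single x k" "x \<notin> supp w"
      unfolding k_def using obtain_slice by metis
    have wz: "w + X z \<in> slice x k M" using t w x by (auto simp: slice_def supp_add ac_simps)
    have k: "k \<le> d" using slice_eq_empty[OF x(1) M, of k] wz by (cases "k \<le> d") auto
    have lex: "lexseg (V - {x}) (d - k) (slice x k M)"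
      using slice_compress[OF V(1) x(1) M k] lexseg_lseg_slice[OF V(1) x(1) M, of k] C[OF x(1)] by simp
    have "w + X z \<in> Mon (V - {x}) (d - k)" using lex wz by (auto simp: lexseg_def)
    then have "w + X i \<in> Mon (V - {x}) (d - k)" using x i by (auto simp: Mon_def supp_add mdeg_add)
    moreover have "w + X z < w + X i"
      using False V(3)[OF i] by (intro add_strict_left_mono X_less) auto
    ultimately have "w + X i \<in> slice x k M" using lexsegD[OF lex wz] by blast
    then show ?thesis using w by (simp add: slice_def ac_simps)
  qed (use t in simp)
qed

section \<open>One and two variables, and Macaulay's theorem\<close>

lemma lex_growth_1: "lex_growth 1 d c \<le> c"
proof (induction d)
  case (Suc d)
  then show ?case using lex_growth.simps(3)[of 0 d c] by (cases "c \<le> mon_count 1 d") auto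
qed simp

lemma mon_count_1: "mon_count (Suc 0) d = 1"
  by (induction d) auto

lemma mon_count_2: "mon_count (Suc (Suc 0)) d = Suc d"
  by (induction d) (auto simp: mon_count_1)

text \<open>With two variables a nonempty lex segment is a run of consecutive monomials, and its
  products with the two variables overlap in all but one.\<close>

lemma lex_growth_2: "lex_growth (Suc (Suc 0)) d c \<le> Suc c"
proof (induction d)
  case (Suc d)
  show ?case
  proof (cases "c \<le> Suc d")
    case True
    then show ?thesis using Suc by (simp add: mon_count_2)
  next
    case False
    then show ?thesis using lex_growth_1[of "Suc d" "c - Suc d"]
      by (simp add: mon_count_2 mon_count_1 del: lex_growth.simps) (simp add: mon_count_2 mon_count_1)
  qed
qed simp

lemma card_le_card_shadow:
  assumes "finite V" "x \<in> V" "M \<subseteq> Mon V d"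
  shows "card M \<le> card (shadow V M)"
proof -
  have "(\<lambda>w. w + X x) ` M \<subseteq> shadow V M" using assms by (auto simp: shadow_def)
  then show ?thesis using card_mono[OF finite_shadow[OF assms(1,3)]] card_image_add[of "X x" M] by metis
qed

text \<open>The products with the larger variable \<open>x\<close> are distinct, and the least
  monomial times \<open>y\<close> lies below all of them.\<close>

lemma Suc_card_le_card_shadow:
  assumes "finite V" "x \<in> V" "y \<in> V" "x < y" "M \<subseteq> Mon V d" "M \<noteq> {}"
  shows "Suc (card M) \<le> card (shadow V M)"
proof -
  have fin: "finite M" using assms finite_subset finite_Mon by blast
  let ?m = "Min M"
  have m: "?m \<in> M" using fin assms by simp
  have "?m + X y \<notin> (\<lambda>w. w + X x) ` M"
  proof
    assume "?m + X y \<in> (\<lambda>w. w + X x) ` M"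
    then obtain w where w: "w \<in> M" "?m + X y = w + X x" by auto
    have "?m + X y < ?m + X x" using assms by (intro add_strict_left_mono X_less)
    then have "w < ?m" using w by simp
    then show False using w fin by (meson Min_le leD)
  qed
  then have "Suc (card M) = card (insert (?m + X y) ((\<lambda>w. w + X x) ` M))"
    using fin by simp
  also have "\<dots> \<le> card (shadow V M)"
    using assms m by (intro card_mono finite_shadow[OF assms(1,5)]) (auto simp: shadow_def)
  finally show ?thesis .
qed

text \<open>The inner induction runs over the rank sum. A set that no compression changes is stable,
  as is the lex segment of the same size; for both, \<open>card_shadow_stable\<close> reduces the
  comparison to the \<open>z\<close>-free parts, which \<open>stable_slice_0\<close> compares. With
  two variables compression changes nothing, since every slice has at most one element.\<close>

theorem macaulay:
  assumes "finite V" "M \<subseteq> Mon V d"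
  shows "lex_growth (card V) d (card M) \<le> card (shadow V M)"
  using assms
proof (induction "card V" arbitrary: V d M rule: less_induct)
  case less
  note V = less.prems(1)
  consider "card V = 0" | "card V = 1" | "card V = 2" | "3 \<le> card V" by linarith
  then show ?case
  proof cases
    case 1
    then show ?thesis by simp
  next
    case 2
    then obtain x where "x \<in> V" by fastforce
    then show ?thesis using 2 lex_growth_1[of d "card M"] card_le_card_shadow[OF V _ less.prems(2)]
      by (metis order_trans)
  next
    case 3
    then obtain x y where "x \<in> V" "y \<in> V" "x < y"
      by (metis card_2_iff insertCI linorder_neqE_nat)
    then show ?thesis using 3 lex_growth_2[of d "card M"] Suc_card_le_card_shadow[OF V _ _ _ less.prems(2)]
      by (cases "M = {}") (auto simp: numeral_2_eq_2 intro: order_trans)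
  next
    case 4
    have IH: "lex_growth (card V - 1) e (card N) \<le> card (shadow (V - {x}) N)"
      if "x \<in> V" "N \<subseteq> Mon (V - {x}) e" for x e N
      using less.hyps[of "V - {x}" N e] that V 4 by simp
    show ?thesis using less.prems(2)
    proof (induction "sum (lex_rank V d) M" arbitrary: M rule: less_induct)
      case (less M)
      note M = less.prems
      show ?case
      proof (cases "\<exists>x\<in>V. compress V d x M \<noteq> M")
        case True
        then obtain x where x: "x \<in> V" "compress V d x M \<noteq> M" by blast
        have "lex_growth (card V) d (card (compress V d x M)) \<le> card (shadow V (compress V d x M))"
          using less.hyps lex_rank_compress[OF V x(1) M x(2)] compress_subset[OF V x(1) M] by blast
        also have "\<dots> = (\<Sum>k\<le>Suc d. slice_bound V d x M k)"
          by (rule card_shadow_compress[OF V x(1) M])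
        also have "\<dots> \<le> (\<Sum>k\<le>Suc d. card (slice x k (shadow V M)))"
          using slice_bound_le[OF V x(1) M IH[OF x(1)]] by (intro sum_mono) auto
        also have "\<dots> = card (shadow V M)"
          by (rule card_slices[OF V shadow_subset[OF M], symmetric])
        finally show ?thesis by (simp add: card_compress[OF V x(1) M])
      next
        case False
        define z where "z = Max V"
        define y where "y = Max (V - {z})"
        have ne: "V \<noteq> {}" using 4 by auto
        then have z: "z \<in> V" "\<And>i. i \<in> V \<Longrightarrow> i \<le> z" using V by (auto simp: z_def)
        have "card (V - {z}) \<noteq> 0" using 4 card_Diff_singleton[OF z(1)] by simp
        then have "V - {z} \<noteq> {}" by fastforce
        then have y: "y \<in> V - {z}" "\<And>i. i \<in> V \<Longrightarrow> i \<noteq> z \<Longrightarrow> i \<le> y"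
          using V Max_in[of "V - {z}"] by (auto simp: y_def)
        then have yz: "y < z" using z(2)[of y] by auto
        have st: "stable V z M" using False by (intro stable_if_compressed[OF V z 4 M]) auto
        define L where "L = lseg V d (card M)"
        have cM: "card M \<le> card (Mon V d)" using M V by (intro card_mono) auto
        have L: "lexseg V d L" "card L = card M"
          using lexseg_lseg[OF V cM] card_lseg[OF V cM] by (auto simp: L_def)
        have LM: "L \<subseteq> Mon V d" using L by (simp add: lexseg_def)
        have lexM0: "lexseg (V - {z}) d (slice z 0 M)"
          using slice_compress[OF V z(1) M, of 0] lexseg_lseg_slice[OF V z(1) M, of 0] False z(1) by simp
        have sub: "slice z 0 L \<subseteq> slice z 0 M"
          using stable_slice_0[OF V z(1) _ yz y(2) L(1) M st lexM0 L(2)] y(1) by blast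
        have "lex_growth (card V) d (card M) = card (shadow V L)"
          using card_shadow_lexseg[OF V L(1)] L(2) by simp
        also have "\<dots> = card (shadow (V - {z}) (slice z 0 L)) + card L"
          by (rule card_shadow_stable[OF V z(1) LM stable_lexseg[OF L(1) z]])
        also have "\<dots> \<le> card (shadow (V - {z}) (slice z 0 M)) + card M"
        proof -
          have "finite (shadow (V - {z}) (slice z 0 M))"
            using V by (intro finite_shadow[OF _ slice_subset[OF z(1) M]]) auto
          then show ?thesis using card_mono[OF _ shadow_mono[OF sub]] L(2) by simp
        qed
        also have "\<dots> = card (shadow V M)"
          by (rule card_shadow_stable[OF V z(1) M st, symmetric])
        finally show ?thesis .
      qed
    qed
  qed
qed

section \<open>Squarefree ideals of minimal growth\<close>

text \<open>A squarefree monomial ideal is encoded by a monotone predicate \<open>f\<close> on sets of variables: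
  the monomial \<open>u\<close> lies in the ideal iff \<open>f (supp u)\<close>.\<close>

definition ideal_part :: "nat set \<Rightarrow> (nat set \<Rightarrow> bool) \<Rightarrow> nat \<Rightarrow> (nat \<Rightarrow>\<^sub>0 nat) set" where
  "ideal_part V f d = {u \<in> Mon V d. f (supp u)}"

definition growth_minimal :: "nat set \<Rightarrow> (nat set \<Rightarrow> bool) \<Rightarrow> bool" where
  "growth_minimal V f \<longleftrightarrow>
     (\<forall>d. card (shadow V (ideal_part V f d)) = lex_growth (card V) d (card (ideal_part V f d)))"

text \<open>Monotone decision lists: each step queries a fresh variable, rejects if it is absent
  (\<open>dl_conj\<close>) or accepts if it is present (\<open>dl_disj\<close>), and otherwise
  passes on. \<open>dl_zero\<close> leaves \<open>V\<close> free, so variables may remain unqueried;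
  no rule yields the constant \<open>True\<close>, which keeps the ideal proper.\<close>

inductive decision_list :: "nat set \<Rightarrow> (nat set \<Rightarrow> bool) \<Rightarrow> bool" where
  dl_zero: "decision_list V (\<lambda>_. False)"
| dl_conj: "decision_list V f \<Longrightarrow> x \<notin> V \<Longrightarrow> decision_list (insert x V) (\<lambda>A. x \<in> A \<and> f A)"
| dl_disj: "decision_list V f \<Longrightarrow> x \<notin> V \<Longrightarrow> decision_list (insert x V) (\<lambda>A. x \<in> A \<or> f A)"

lemma ideal_part_subset: "ideal_part V f d \<subseteq> Mon V d"
  by (auto simp: ideal_part_def)

lemma finite_ideal_part: "finite V \<Longrightarrow> finite (ideal_part V f d)"
  using finite_subset[OF ideal_part_subset] by simp

lemma card_ideal_part_le: "finite V \<Longrightarrow> card (ideal_part V f d) \<le> mon_count (card V) d"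
  using card_mono[OF finite_Mon ideal_part_subset] card_Mon by metis

lemma decision_list_not_empty: "decision_list V f \<Longrightarrow> \<not> f {}"
  by (induction rule: decision_list.induct) auto

lemma decision_list_local: "decision_list V f \<Longrightarrow> A \<inter> V = B \<inter> V \<Longrightarrow> f A = f B"
proof (induction arbitrary: A B rule: decision_list.induct)
  case (dl_conj V f x)
  then have "x \<in> A \<longleftrightarrow> x \<in> B" "A \<inter> V = B \<inter> V" by auto
  then show ?case using dl_conj.IH by blast
next
  case (dl_disj V f x)
  then have "x \<in> A \<longleftrightarrow> x \<in> B" "A \<inter> V = B \<inter> V" by auto
  then show ?case using dl_disj.IH by blast
qed simp

lemma decision_list_insert:
  assumes "decision_list V f" "x \<notin> V"
  shows "f (insert x A) = f A"
  by (rule decision_list_local[OF assms(1)]) (use assms(2) in auto)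

lemma ideal_part_0: "\<not> f {} \<Longrightarrow> ideal_part V f 0 = {}"
  by (auto simp: ideal_part_def)

lemma ideal_part_conj:
  assumes "x \<in> V" "\<And>A. f (insert x A) = f A"
  shows "ideal_part V (\<lambda>A. x \<in> A \<and> f A) (Suc d) = (\<lambda>w. w + X x) ` ideal_part V f d"
proof
  show "ideal_part V (\<lambda>A. x \<in> A \<and> f A) (Suc d) \<subseteq> (\<lambda>w. w + X x) ` ideal_part V f d"
  proof
    fix u assume u: "u \<in> ideal_part V (\<lambda>A. x \<in> A \<and> f A) (Suc d)"
    then have "x \<in> supp u" by (simp add: ideal_part_def)
    then obtain w where w: "u = w + X x" using obtain_factor by metis
    with u assms have "w \<in> ideal_part V f d"
      by (simp add: ideal_part_def Mon_add_X_iff supp_add)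
    then show "u \<in> (\<lambda>w. w + X x) ` ideal_part V f d" using w by blast
  qed
  show "(\<lambda>w. w + X x) ` ideal_part V f d \<subseteq> ideal_part V (\<lambda>A. x \<in> A \<and> f A) (Suc d)"
  proof
    fix u assume "u \<in> (\<lambda>w. w + X x) ` ideal_part V f d"
    then obtain w where "u = w + X x" "w \<in> Mon V d" "f (supp w)" by (auto simp: ideal_part_def)
    then show "u \<in> ideal_part V (\<lambda>A. x \<in> A \<and> f A) (Suc d)"
      using assms(1) assms(2)[of "supp w"] by (simp add: ideal_part_def Mon_add_X_iff supp_add)
  qed
qed

lemma ideal_part_disj:
  assumes "x \<in> V"
  shows "ideal_part V (\<lambda>A. x \<in> A \<or> f A) (Suc d) = (\<lambda>w. w + X x) ` Mon V d \<union> ideal_part (V - {x}) f (Suc d)"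
proof -
  have "x \<notin> supp u" if "u \<in> Mon (V - {x}) (Suc d)" for u using that by (auto simp: Mon_def)
  then show ?thesis
    unfolding ideal_part_def Mon_split[OF assms] by (auto simp: supp_add)
qed

text \<open>The ring variables \<open>V\<close> may exceed the queried ones \<open>W\<close> because
  the two steps treat the ring differently: after dividing by \<open>x\<close> the ideal still lives
  in all of \<open>V\<close>, while modulo \<open>x\<close> it lives in
  \<open>V - {x}\<close>.\<close>

theorem growth_minimal_decision_list:
  assumes "decision_list W f" "finite V" "W \<subseteq> V"
  shows "growth_minimal V f"
  using assms
proof (induction arbitrary: V rule: decision_list.induct)
  case (dl_zero W)
  then show ?case by (simp add: growth_minimal_def ideal_part_def)
next
  case (dl_conj W f x)
  let ?g = "\<lambda>A. x \<in> A \<and> f A"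
  have IH: "growth_minimal V f" using dl_conj by auto
  have x: "x \<in> V" using dl_conj by auto
  show ?case unfolding growth_minimal_def
  proof
    fix d
    show "card (shadow V (ideal_part V ?g d)) = lex_growth (card V) d (card (ideal_part V ?g d))"
    proof (cases d)
      case (Suc e)
      have eq: "ideal_part V ?g d = (\<lambda>w. w + X x) ` ideal_part V f e"
        unfolding Suc using decision_list_insert[OF dl_conj(1,2)] by (intro ideal_part_conj[OF x]) auto
      have "lex_growth (card V) d (card (ideal_part V f e)) = lex_growth (card V) e (card (ideal_part V f e))"
        unfolding Suc by (rule lex_growth_Suc[OF card_ideal_part_le[OF dl_conj(4)]])
      then show ?thesis using IH unfolding eq shadow_image_add card_image_add growth_minimal_def by simp
    qed (simp add: ideal_part_0)
  qed
next
  case (dl_disj W f x)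
  let ?g = "\<lambda>A. x \<in> A \<or> f A"
  have IH: "growth_minimal (V - {x}) f" using dl_disj by auto
  have x: "x \<in> V" using dl_disj by auto
  then obtain n where n: "card V = Suc n" "card (V - {x}) = n"
    using dl_disj(4) by (metis card_Suc_Diff1)
  show ?case unfolding growth_minimal_def
  proof
    fix d
    show "card (shadow V (ideal_part V ?g d)) = lex_growth (card V) d (card (ideal_part V ?g d))"
    proof (cases d)
      case 0
      have "\<not> f {}" using dl_disj(1) by (rule decision_list_not_empty)
      then show ?thesis using 0 by (simp add: ideal_part_0)
    next
      case (Suc e)
      have "card (shadow V (ideal_part V ?g d)) = mon_count (Suc n) d + lex_growth n d (card (ideal_part (V - {x}) f d))"
        using card_shadow_split[OF dl_disj(4) x ideal_part_subset] IH n
        unfolding Suc ideal_part_disj[OF x] growth_minimal_def by simp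
      moreover have "card (ideal_part V ?g d) = mon_count (Suc n) e + card (ideal_part (V - {x}) f d)"
        using card_split[OF dl_disj(4) x ideal_part_subset] n
        unfolding Suc ideal_part_disj[OF x] by simp
      ultimately show ?thesis using n unfolding Suc by (simp only: lex_growth_add)
    qed
  qed
qed

section \<open>Deletion and link inherit minimal growth\<close>

lemma slice_0_ideal_part:
  assumes "x \<in> V"
  shows "slice x 0 (ideal_part V f d) = ideal_part (V - {x}) f d"
  by (auto simp: slice_def ideal_part_def Mon_def)

lemma slice_1_ideal_part:
  assumes "x \<in> V"
  shows "slice x (Suc 0) (ideal_part V f (Suc d)) = ideal_part (V - {x}) (\<lambda>A. f (insert x A)) d"
  using assms by (auto simp: slice_def ideal_part_def Mon_add_X_iff supp_add) (auto simp: Mon_def)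

text \<open>Equality in Macaulay's bound is inherited by every slice, because compression
  can only decrease the slices of the shadow.\<close>

lemma slice_shadow_growth_minimal:
  assumes V: "finite V" and x: "x \<in> V" and gm: "growth_minimal V f" and k: "k \<le> Suc d"
  shows "card (slice x k (shadow V (ideal_part V f d))) = slice_bound V d x (ideal_part V f d) k"
proof -
  let ?M = "ideal_part V f d"
  note M = ideal_part_subset[of V f d]
  have le: "slice_bound V d x ?M j \<le> card (slice x j (shadow V ?M))" for j
    by (rule slice_bound_le[OF V x M]) (use macaulay[of "V - {x}"] V x in auto)
  have "(\<Sum>j\<le>Suc d. card (slice x j (shadow V ?M))) = card (shadow V ?M)"
    by (rule card_slices[OF V shadow_subset[OF M], symmetric])
  also have "\<dots> = lex_growth (card V) d (card (compress V d x ?M))"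
    using gm by (simp add: growth_minimal_def card_compress[OF V x M])
  also have "\<dots> \<le> card (shadow V (compress V d x ?M))"
    by (rule macaulay[OF V compress_subset[OF V x M]])
  also have "\<dots> = (\<Sum>j\<le>Suc d. slice_bound V d x ?M j)"
    by (rule card_shadow_compress[OF V x M])
  \<comment> \<open>Minimal growth leaves compression nothing to gain in total, so with the termwise
    inequality \<open>le\<close> it gains nothing in any slice.\<close>
  finally have "(\<Sum>j\<le>Suc d. slice_bound V d x ?M j) = (\<Sum>j\<le>Suc d. card (slice x j (shadow V ?M)))"
    using sum_mono[of "{..Suc d}", OF le] by (intro antisym) auto
  then have "slice_bound V d x ?M k = card (slice x k (shadow V ?M))"
    by (rule sum_mono_inv[OF _ le]) (use k in auto)
  then show ?thesis by simp
qed

text \<open>In slice 0 nothing arrives from a lower exponent, so \<open>slice_bound\<close> is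
  exactly Macaulay's bound for the deletion.\<close>

lemma growth_minimal_delete:
  assumes V: "finite V" and x: "x \<in> V" and gm: "growth_minimal V f"
  shows "growth_minimal (V - {x}) f"
  unfolding growth_minimal_def
  using slice_shadow_growth_minimal[OF assms, of 0] V x
  by (simp add: slice_bound_def[OF V x ideal_part_subset] slice_shadow[OF x] slice_0_ideal_part)

text \<open>Slice 1 of the shadow in degree \<open>d + 1\<close> mixes the shadow of the link
  \<open>?M\<close> with the deletion \<open>?N\<close>, and only the size of the union is known. If
  the bound for \<open>?M\<close> dominates, Macaulay pins down its shadow; if \<open>?N\<close>
  dominates, it absorbs that shadow, and then link and deletion coincide in degree
  \<open>d\<close>.\<close>

lemma growth_minimal_link:
  assumes V: "finite V" and x: "x \<in> V" and gm: "growth_minimal V f"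
    and mono: "\<And>A B. A \<subseteq> B \<Longrightarrow> f A \<Longrightarrow> f B" and nx: "\<not> f {x}"
  shows "growth_minimal (V - {x}) (\<lambda>A. f (insert x A))"
  unfolding growth_minimal_def
proof
  fix d
  let ?W = "V - {x}" and ?g = "\<lambda>A. f (insert x A)"
  let ?M = "ideal_part ?W ?g d" and ?N = "ideal_part ?W f (Suc d)"
  have W: "finite ?W" "card ?W = card V - 1" using V x by auto
  have fin: "finite (shadow ?W ?M)" "finite ?N"
    using finite_shadow[OF W(1) ideal_part_subset] finite_ideal_part[OF W(1)] by auto
  have eq: "card (shadow ?W ?M \<union> ?N) = max (lex_growth (card ?W) d (card ?M)) (card ?N)"
    using slice_shadow_growth_minimal[OF V x gm, of 1 "Suc d"] W
    by (simp add: slice_bound_def[OF V x ideal_part_subset] slice_shadow[OF x] slice_0_ideal_part[OF x]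
        slice_1_ideal_part[OF x])
  show "card (shadow ?W ?M) = lex_growth (card ?W) d (card ?M)"
  proof (cases "card ?N \<le> lex_growth (card ?W) d (card ?M)")
    case True
    then have "card (shadow ?W ?M \<union> ?N) = lex_growth (card ?W) d (card ?M)" using eq by simp
    moreover have "card (shadow ?W ?M) \<le> card (shadow ?W ?M \<union> ?N)" using fin by (intro card_mono) auto
    ultimately show ?thesis using macaulay[OF W(1) ideal_part_subset[of ?W ?g d]] by simp
  next
    case False
    then have "card (shadow ?W ?M \<union> ?N) = card ?N" using eq by simp
    then have "shadow ?W ?M \<union> ?N = ?N" using fin by (metis Un_upper2 card_subset_eq finite_UnI)
    then have sub: "shadow ?W ?M \<subseteq> ?N" by blast
    \<comment> \<open>Multiplying \<open>w\<close> by one of its own variables keeps the support, so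
      membership of the product in the deletion passes back to \<open>w\<close>. Such a variable
      exists because \<open>\<not> f {x}\<close> keeps 1 out of the link.\<close>
    have "?M = ideal_part ?W f d"
    proof
      show "ideal_part ?W f d \<subseteq> ?M" using mono by (auto simp: ideal_part_def intro: mono)
      show "?M \<subseteq> ideal_part ?W f d"
      proof
        fix w assume w: "w \<in> ?M"
        then have "supp w \<noteq> {}" using nx by (auto simp: ideal_part_def)
        then obtain j where j: "j \<in> supp w" by blast
        then have "j \<in> ?W" using w by (auto simp: ideal_part_def Mon_def)
        then have "w + X j \<in> shadow ?W ?M" using w unfolding shadow_def by blast
        then have "f (supp (w + X j))" using sub by (auto simp: ideal_part_def)
        moreover have "supp (w + X j) = supp w" using j by (auto simp: supp_add)
        ultimately show "w \<in> ideal_part ?W f d" using w by (simp add: ideal_part_def)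
      qed
    qed
    then show ?thesis using growth_minimal_delete[OF V x gm] by (simp add: growth_minimal_def)
  qed
qed

section \<open>The two obstructions\<close>

definition sqmon :: "nat set \<Rightarrow> nat \<Rightarrow>\<^sub>0 nat" where
  "sqmon A = (\<Sum>i\<in>A. X i)"

lemma expo_sqmon: "finite A \<Longrightarrow> expo (sqmon A) j = (if j \<in> A then 1 else 0)"
  by (simp add: sqmon_def lookup_sum expo_X)

lemma supp_sqmon: "finite A \<Longrightarrow> supp (sqmon A) = A"
  by (auto simp: in_keys_iff expo_sqmon split: if_splits)

lemma mdeg_sqmon: "finite A \<Longrightarrow> mdeg (sqmon A) = card A"
  by (simp add: mdeg_def supp_sqmon expo_sqmon)

lemma eq_sqmon:
  assumes "mdeg u = card (supp u)"
  shows "u = sqmon (supp u)"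
proof (rule poly_mapping_eqI)
  fix i
  have "expo u j = 1" if "j \<in> supp u" for j
  proof (rule ccontr)
    assume "expo u j \<noteq> 1"
    moreover have "0 < expo u j" using that by (auto simp: in_keys_iff)
    ultimately have "1 < expo u j" by simp
    have "(\<Sum>i\<in>supp u. 1) < sum (expo u) (supp u)"
      by (rule sum_strict_mono_ex1) (use \<open>1 < expo u j\<close> that in \<open>auto simp: in_keys_iff Suc_le_eq\<close>)
    then show False using assms by (simp add: mdeg_def)
  qed
  then show "expo u i = expo (sqmon (supp u)) i" by (simp add: expo_sqmon in_keys_iff)
qed

text \<open>A finite check: 10 is the number of quadratic monomials in four variables, and
  \<open>2 * c + 4\<close> counts the cubics found above \<open>c\<close> edges in the matching
  obstruction.\<close>

lemma lex_growth_4_2: "c \<le> 10 \<Longrightarrow> lex_growth 4 2 c < 2 * c + 4"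
proof -
  have "\<forall>c<11. lex_growth 4 2 c < 2 * c + 4"
    by (simp add: eval_nat_numeral All_less_Suc)
  then show "c \<le> 10 \<Longrightarrow> lex_growth 4 2 c < 2 * c + 4" by simp
qed

lemma mon_count_4_2: "mon_count 4 2 = 10"
  by (simp add: eval_nat_numeral)

text \<open>The quadrics are edges \<open>p q\<close>. Each yields the cubics \<open>p^2 q\<close>
  and \<open>p q^2\<close> (\<open>S1\<close>), and by \<open>edge\<close> each of the four
  squarefree cubics lies above an edge (\<open>S2\<close>). All of these are distinct, and they
  outnumber the shadow of a lex segment of equally many quadrics.\<close>

lemma not_growth_minimal_matching:
  assumes V: "finite V" "card V = 4" and f0: "\<not> f {}" and f1: "\<And>x. x \<in> V \<Longrightarrow> \<not> f {x}"
    and edge: "\<And>v. v \<in> V \<Longrightarrow> \<exists>p q. p \<noteq> q \<and> {p, q} \<subseteq> V - {v} \<and> f {p, q}"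
  shows "\<not> growth_minimal V f"
proof
  assume gm: "growth_minimal V f"
  let ?M = "ideal_part V f 2"
  have M: "\<exists>p q. p \<noteq> q \<and> m = X p + X q" if m: "m \<in> ?M" for m
  proof -
    have mV: "supp m \<subseteq> V" "mdeg m = 2" "f (supp m)" using m by (auto simp: ideal_part_def Mon_def)
    then obtain p where "p \<in> supp m" using f0 by fastforce
    then obtain w where w: "m = w + X p" "mdeg m = Suc (mdeg w)" using obtain_factor by metis
    then have "w \<noteq> 0" using mV by auto
    then obtain q where "q \<in> supp w" by (metis mdeg_def mdeg_eq_0_iff sum.empty ex_in_conv)
    then obtain t where t: "w = t + X q" "mdeg w = Suc (mdeg t)" using obtain_factor by metis
    then have "t = 0" using w mV mdeg_eq_0_iff[of t] by simp
    then have mm: "m = X q + X p" using w t by simp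
    have "q \<noteq> p" using f1[of p] mV mm by (auto simp: supp_add)
    then show ?thesis using mm by blast
  qed
  have supp2: "card (supp m) = 2" if "m \<in> ?M" for m using M[OF that] by (auto simp: supp_add)
  have expo1: "expo m i = (if i \<in> supp m then 1 else 0)" if "m \<in> ?M" for m i
    using M[OF that] by (auto simp: supp_add lookup_add expo_X)
  have fin: "finite ?M" by (rule finite_ideal_part[OF V(1)])
  define S1 where "S1 = (\<lambda>(m, u). m + X u) ` Sigma ?M supp"
  define S2 where "S2 = (\<lambda>v. sqmon (V - {v})) ` V"
  have "inj_on (\<lambda>(m, u). m + X u) (Sigma ?M supp)"
  proof (rule inj_onI, clarify)
    fix m u m' u' assume mu: "m \<in> ?M" "u \<in> supp m" "m' \<in> ?M" "u' \<in> supp m'" "m + X u = m' + X u'"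
    have "u = u'"
    proof (rule ccontr)
      assume "u \<noteq> u'"
      then have "expo m u + 1 = expo m' u" using arg_cong[OF mu(5), of "\<lambda>w. expo w u"] by (simp add: lookup_add expo_X)
      then show False using expo1[OF mu(1), of u] expo1[OF mu(3), of u] mu(2) by (auto split: if_splits)
    qed
    then show "m = m' \<and> u = u'" using mu(5) by simp
  qed
  then have c1: "card S1 = 2 * card ?M"
    unfolding S1_def using fin supp2 by (simp add: card_image)
  have "inj_on (\<lambda>v. sqmon (V - {v})) V"
  proof (rule inj_onI)
    fix v v' assume v: "v \<in> V" "v' \<in> V" "sqmon (V - {v}) = sqmon (V - {v'})"
    then have "V - {v} = V - {v'}" using V(1) supp_sqmon by (metis finite_Diff)
    then show "v = v'" using v by blast
  qed
  then have c2: "card S2 = 4" unfolding S2_def using V by (simp add: card_image)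
  have "s \<notin> S2" if s: "s \<in> S1" for s
  proof -
    obtain m u where "m \<in> ?M" "u \<in> supp m" "s = m + X u" using s by (auto simp: S1_def)
    then have "expo s u = 2" using expo1[of m u] by (simp add: lookup_add expo_X)
    then show ?thesis using V(1) by (auto simp: S2_def expo_sqmon split: if_splits)
  qed
  then have disj: "S1 \<inter> S2 = {}" by blast
  have "S1 \<subseteq> shadow V ?M" by (auto simp: S1_def shadow_def ideal_part_def Mon_def)
  moreover have "S2 \<subseteq> shadow V ?M"
  proof
    fix s assume "s \<in> S2"
    then obtain v where v: "v \<in> V" "s = sqmon (V - {v})" by (auto simp: S2_def)
    obtain p q where pq: "p \<noteq> q" "{p, q} \<subseteq> V - {v}" "f {p, q}" using edge[OF v(1)] by blast
    have "card (V - {v} - {p, q}) = 1" using V v pq by (simp add: card_Diff_subset)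
    then obtain r where r: "V - {v} - {p, q} = {r}" by (rule card_1_singletonE)
    then have "V - {v} = insert r {p, q}" "r \<notin> {p, q}" "r \<in> V" using pq by auto
    then have "s = sqmon {p, q} + X r" unfolding v(2) by (simp add: sqmon_def ac_simps)
    moreover have "sqmon {p, q} \<in> ?M"
      using pq by (auto simp: ideal_part_def Mon_def supp_sqmon mdeg_sqmon)
    ultimately show "s \<in> shadow V ?M" using \<open>r \<in> V\<close> by (auto simp: shadow_def)
  qed
  ultimately have "card (S1 \<union> S2) \<le> card (shadow V ?M)"
    by (intro card_mono finite_shadow[OF V(1) ideal_part_subset]) auto
  moreover have "card (S1 \<union> S2) = 2 * card ?M + 4"
    using disj c1 c2 V(1) fin by (subst card_Un_disjoint) (auto simp: S1_def S2_def)
  moreover have "card ?M \<le> 10" using card_ideal_part_le[OF V(1), of f 2] V(2) by (simp add: mon_count_4_2)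
  ultimately show False
    using gm lex_growth_4_2[of "card ?M"] V(2) by (simp add: growth_minimal_def)
qed

text \<open>The obstruction \<open>x\<^sub>1(x\<^sub>2,\<dots>,x\<^sub>n) + (x\<^sub>2\<cdots>x\<^sub>n)\<close>: in degree \<open>n - 1\<close> it has as many monomials as
  \<open>S\<close> in degree \<open>n - 2\<close>, but grows faster.\<close>

lemma not_growth_minimal_star:
  assumes V: "finite V" "a \<in> V" "3 \<le> card V" and mono: "\<And>A B. A \<subseteq> B \<Longrightarrow> f A \<Longrightarrow> f B"
    and f1: "\<not> f {a}" and star: "\<And>v. v \<in> V - {a} \<Longrightarrow> f {a, v}" and rest: "f (V - {a})"
    and only: "\<And>A. f A \<Longrightarrow> a \<notin> A \<Longrightarrow> V - {a} \<subseteq> A"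
  shows "\<not> growth_minimal V f"
proof
  assume gm: "growth_minimal V f"
  \<comment> \<open>\<open>e\<close> is n - 2, so \<open>?d\<close> is the degree n - 1 of the
    monomial \<open>?p\<close>.\<close>
  obtain e where e: "card V = Suc (Suc e)" "1 \<le> e"
    using V(3) by (metis One_nat_def Suc_le_D Suc_le_mono numeral_3_eq_3)
  let ?d = "Suc e" and ?W = "V - {a}"
  let ?M = "ideal_part V f ?d" and ?p = "sqmon (V - {a})"
  have W: "finite ?W" "card ?W = ?d" using V e by auto
  \<comment> \<open>All monomials of degree \<open>k\<close> except the pure power of
    \<open>a\<close>; by \<open>star\<close>, times \<open>a\<close> they lie in the ideal.\<close>
  define R where "R k = Mon V k - {Poly_Mapping.single a k}" for k
  have key: "\<exists>v\<in>?W. v \<in> supp w" if w: "w \<in> R k" for w k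
  proof (rule ccontr)
    assume "\<not> ?thesis"
    then have "supp w \<subseteq> {a}" using w by (auto simp: R_def Mon_def)
    then have "w = Poly_Mapping.single a k"
      using w mdeg_superset[of "{a}" w]
      by (intro poly_mapping_eqI) (auto simp: R_def Mon_def lookup_single when_def in_keys_iff)
    then show False using w by (simp add: R_def)
  qed
  have R_I: "w \<in> R k" if "w \<in> Mon V k" "v \<in> supp w" "v \<noteq> a" for w k v
    using that by (auto simp: R_def split: if_splits)
  have cR: "Suc (card (R k)) = mon_count (card V) k" for k
  proof -
    have "Poly_Mapping.single a k \<in> Mon V k" using V by (auto simp: Mon_def)
    then show ?thesis using V(1) unfolding R_def by (simp only: card_Mon[symmetric] finite_Mon card_Suc_Diff1)
  qed
  have finR: "finite (R k)" for k using V by (simp add: R_def)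
  have pM: "?p \<in> ?M" using rest W by (auto simp: ideal_part_def Mon_def supp_sqmon mdeg_sqmon)
  have ap: "a \<notin> supp ?p" using W by (simp add: supp_sqmon)
  have M: "?M = insert ?p ((\<lambda>w. w + X a) ` R e)"
  proof
    show "?M \<subseteq> insert ?p ((\<lambda>w. w + X a) ` R e)"
    proof
      fix u assume u: "u \<in> ?M"
      then have uV: "u \<in> Mon V ?d" "f (supp u)" by (auto simp: ideal_part_def)
      show "u \<in> insert ?p ((\<lambda>w. w + X a) ` R e)"
      proof (cases "a \<in> supp u")
        case True
        then obtain w where w: "u = w + X a" using obtain_factor by metis
        then have "w \<in> Mon V e" using uV by (simp add: Mon_add_X_iff)
        moreover have "w \<noteq> Poly_Mapping.single a e" using uV w f1 by (auto simp: supp_add split: if_splits)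
        ultimately show ?thesis using w by (auto simp: R_def)
      next
        case False
        then have "supp u = ?W" using only uV by (auto simp: Mon_def)
        then have "u = ?p" using eq_sqmon[of u] uV W by (simp add: Mon_def)
        then show ?thesis by simp
      qed
    qed
    have "w + X a \<in> ?M" if w: "w \<in> R e" for w
    proof -
      obtain v where v: "v \<in> ?W" "v \<in> supp w" using key[OF w] by blast
      then have "f (supp (w + X a))" using mono[OF _ star[OF v(1)]] by (auto simp: supp_add)
      then show ?thesis using w V(2) by (auto simp: R_def ideal_part_def Mon_add_X_iff)
    qed
    then show "insert ?p ((\<lambda>w. w + X a) ` R e) \<subseteq> ?M" using pM by auto
  qed
  have "?p \<notin> (\<lambda>w. w + X a) ` R e" using ap by (auto simp: supp_add)
  then have cM: "card ?M = mon_count (card V) e" unfolding M using finR cR by simp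
  have "w + X a \<in> shadow V ?M" if w: "w \<in> R ?d" for w
  proof -
    obtain v where v: "v \<in> ?W" "v \<in> supp w" using key[OF w] by blast
    \<comment> \<open>Divide by \<open>a\<close> if possible, which keeps \<open>v\<close>;
      otherwise the quotient by \<open>v\<close> is free of \<open>a\<close> and, since
      \<open>e \<ge> 1\<close>, not a power of \<open>a\<close>.\<close>
    have "\<exists>t j. w = t + X j \<and> j \<in> V \<and> t \<in> R e"
    proof (cases "a \<in> supp w")
      case True
      then obtain t where t: "w = t + X a" using obtain_factor by metis
      then have "t \<in> R e" using v w R_I[of t e v] by (auto simp: R_def Mon_add_X_iff supp_add)
      then show ?thesis using t V by blast
    next
      case False
      obtain t where t: "w = t + X v" using obtain_factor[OF v(2)] by metis
      then have tM: "t \<in> Mon V e" "a \<notin> supp t" using w False by (auto simp: R_def Mon_add_X_iff supp_add)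
      then have "t \<in> R e" using e(2) by (auto simp: R_def)
      then show ?thesis using t v by blast
    qed
    then obtain t j where t: "w = t + X j" "j \<in> V" "t \<in> R e" by blast
    then have "t + X a \<in> ?M" "w + X a = (t + X a) + X j" unfolding M by (auto simp: ac_simps)
    then show ?thesis using t(2) unfolding shadow_def by blast
  qed
  moreover have "?p + X v \<in> shadow V ?M" if "v \<in> ?W" for v
    using pM that by (auto simp: shadow_def)
  ultimately have sub: "(\<lambda>w. w + X a) ` R ?d \<union> (\<lambda>v. ?p + X v) ` ?W \<subseteq> shadow V ?M" by auto
  have inj: "inj_on (\<lambda>v. ?p + X v) ?W"
    by (auto simp: inj_on_def dest: arg_cong[of _ _ supp])
  have "w + X a \<noteq> ?p + X v" if "v \<in> ?W" for w v
  proof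
    assume "w + X a = ?p + X v"
    then have "a \<in> supp (?p + X v)" by (metis UnI2 keys_single singletonI supp_add zero_neq_one One_nat_def)
    then show False using ap that by (auto simp: supp_add split: if_splits)
  qed
  then have disj: "(\<lambda>w. w + X a) ` R ?d \<inter> (\<lambda>v. ?p + X v) ` ?W = {}" by blast
  \<comment> \<open>\<open>R ?d\<close> falls one short of all monomials of degree
    \<open>?d\<close>, but there are \<open>?d \<ge> 2\<close> products of \<open>?p\<close>. Having
    the size of the full degree \<open>e\<close>, \<open>?M\<close> should only grow to the size of
    the full degree \<open>?d\<close>.\<close>
  have "card (R ?d) + card ?W = card ((\<lambda>w. w + X a) ` R ?d \<union> (\<lambda>v. ?p + X v) ` ?W)"
    using finR W disj by (subst card_Un_disjoint) (auto simp: card_image[OF inj])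
  also have "\<dots> \<le> card (shadow V ?M)"
    by (rule card_mono[OF finite_shadow[OF V(1) ideal_part_subset] sub])
  also have "\<dots> = mon_count (card V) ?d"
    using gm cM by (simp add: growth_minimal_def lex_growth_Suc lex_growth_full del: lex_growth.simps)
  finally show False using cR[of ?d] W e(2) by simp
qed

text \<open>The quadrics of the ideal are viewed as edges of a graph with many two-element vertex
  covers. Two disjoint edges lead to the matching obstruction; pairwise intersecting edges lead to
  the star, whose smallest case, in three variables, is the triangle.\<close>

lemma not_growth_minimal_two_covers:
  assumes V: "finite V" "V \<noteq> {}" and mono: "\<And>A B. A \<subseteq> B \<Longrightarrow> f A \<Longrightarrow> f B"
    and loc: "\<And>A. f A \<Longrightarrow> f (A \<inter> V)" and f0: "\<not> f {}" and f1: "\<And>x. x \<in> V \<Longrightarrow> \<not> f {x}"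
    and P1: "\<And>x. x \<in> V \<Longrightarrow> \<exists>y\<in>V - {x}. \<forall>A. f A \<longrightarrow> x \<in> A \<or> y \<in> A"
    and P2: "\<And>x. x \<in> V \<Longrightarrow> \<exists>z\<in>V - {x}. f {x, z}"
    and P3: "\<And>x. x \<in> V \<Longrightarrow> \<exists>A. f A \<and> x \<notin> A"
  shows "\<not> growth_minimal V f"
proof (cases "\<exists>a b c d. {a, b, c, d} \<subseteq> V \<and> distinct [a, b, c, d] \<and> f {a, b} \<and> f {c, d}")
  case True
  then obtain a b c d where abcd: "{a, b, c, d} \<subseteq> V" "distinct [a, b, c, d]" "f {a, b}" "f {c, d}" by blast
  have "V \<subseteq> {a, b, c, d}"
  proof
    fix v assume v: "v \<in> V"
    \<comment> \<open>The pair \<open>{v, y}\<close> meets two disjoint edges, so \<open>v\<close>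
      lies on one of them.\<close>
    obtain y where "\<forall>A. f A \<longrightarrow> v \<in> A \<or> y \<in> A" using P1[OF v] by blast
    then have "v \<in> {a, b} \<or> y \<in> {a, b}" "v \<in> {c, d} \<or> y \<in> {c, d}" using abcd by blast+
    then show "v \<in> {a, b, c, d}" using abcd(2) by auto
  qed
  then have Veq: "V = {a, b, c, d}" using abcd by blast
  then have "card V = 4" using abcd(2) by simp
  moreover have "\<exists>p q. p \<noteq> q \<and> {p, q} \<subseteq> V - {v} \<and> f {p, q}" if "v \<in> V" for v
  proof (cases "v \<in> {a, b}")
    case True
    then show ?thesis using abcd by (intro exI[of _ c] exI[of _ d]) auto
  next
    case False
    then show ?thesis using abcd by (intro exI[of _ a] exI[of _ b]) auto
  qed
  ultimately show ?thesis using V f0 f1 by (intro not_growth_minimal_matching) auto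
next
  case False
  then have meet: "{p, q} \<inter> {r, s} \<noteq> {}"
    if "p \<in> V" "q \<in> V" "r \<in> V" "s \<in> V" "p \<noteq> q" "r \<noteq> s" "f {p, q}" "f {r, s}" for p q r s
    using that by auto
  obtain a' where a': "a' \<in> V" using V by blast
  obtain b' where b': "b' \<in> V" "a' \<noteq> b'" "f {a', b'}" using P2[OF a'] by auto
  have "\<not> V \<subseteq> {a', b'}"
  proof
    assume sub: "V \<subseteq> {a', b'}"
    obtain A where "f A" "a' \<notin> A" using P3[OF a'] by blast
    then have "f (A \<inter> V)" "A \<inter> V \<subseteq> {b'}" using loc sub by auto
    then show False using mono f1[OF b'(1)] by blast
  qed
  then obtain c where c: "c \<in> V" "c \<noteq> a'" "c \<noteq> b'" by blast
  \<comment> \<open>The edge at \<open>c\<close> must meet \<open>{a', b'}\<close>; the common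
    vertex becomes \<open>a\<close>.\<close>
  obtain w where w: "w \<in> V" "c \<noteq> w" "f {c, w}" using P2[OF c(1)] by auto
  have "w \<in> {a', b'}" using meet[OF c(1) w(1) a' b'(1) w(2) b'(2) w(3) b'(3)] c by auto
  then obtain a b where ab: "a \<in> V" "b \<in> V" "a \<noteq> b" "f {a, b}" "f {a, c}" "c \<noteq> a" "c \<noteq> b"
    using a' b' c w by (auto simp: insert_commute)
  have star: "f {a, v}" if v: "v \<in> V - {a}" for v
  proof (cases "v = b \<or> v = c")
    case False
    \<comment> \<open>The edge at \<open>v\<close> has to meet both \<open>{a, b}\<close> and
      \<open>{a, c}\<close>, hence ends in \<open>a\<close>.\<close>
    obtain z where z: "z \<in> V" "v \<noteq> z" "f {v, z}" using P2[of v] v by auto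
    have "z \<in> {a, b}" "z \<in> {a, c}"
      using meet[OF _ z(1) ab(1,2) z(2) ab(3) z(3) ab(4)] meet[OF _ z(1) ab(1) c(1) z(2) _ z(3) ab(5)] v False ab by auto
    then have "z = a" using ab by auto
    then show ?thesis using z by (simp add: insert_commute)
  qed (use ab in auto)
  have only: "V - {a} \<subseteq> A" if A: "f A" "a \<notin> A" for A
  proof
    fix v assume v: "v \<in> V - {a}"
    show "v \<in> A"
    proof (rule ccontr)
      assume nv: "v \<notin> A"
      obtain y where y: "y \<in> V" "y \<noteq> v" "\<forall>A. f A \<longrightarrow> v \<in> A \<or> y \<in> A" using P1[of v] v by auto
      then have "y \<noteq> a" using A nv by blast
      \<comment> \<open>The cover \<open>{v, y}\<close> meets every edge \<open>{a, u}\<close>, so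
        \<open>a\<close>, \<open>v\<close>, \<open>y\<close> are all the variables. Then
        \<open>A\<close> contains at most \<open>y\<close>, but no single variable lies in the
        ideal.\<close>
      have "V - {a, v} \<subseteq> {y}" using y(3) star \<open>y \<noteq> a\<close> v by blast
      then have "A \<inter> V \<subseteq> {y}" using A nv by auto
      then show False using mono[OF _ loc[OF A(1)]] f1[OF y(1)] by blast
    qed
  qed
  obtain A where A: "f A" "a \<notin> A" using P3[OF ab(1)] by blast
  have rest: "f (V - {a})" using mono[OF _ loc[OF A(1)], of "V - {a}"] A(2) by auto
  have "3 \<le> card V"
    using card_mono[of V "{a, b, c}"] V ab c by auto
  then show ?thesis
    by (rule not_growth_minimal_star[OF V(1) ab(1) _ mono f1[OF ab(1)] star rest only])
qed

section \<open>Induction on the number of variables\<close>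

lemma decision_list_cases:
  assumes "decision_list W g"
  shows "(\<forall>A. \<not> g A) \<or> (\<exists>y\<in>W. g {y}) \<or> (\<exists>y\<in>W. \<forall>A. g A \<longrightarrow> y \<in> A)"
  using assms by (cases rule: decision_list.cases) auto

theorem decision_list_if_growth_minimal:
  assumes "finite V" and mono: "\<And>A B. A \<subseteq> B \<Longrightarrow> f A \<Longrightarrow> f B"
    and loc: "\<And>A. f A \<longleftrightarrow> f (A \<inter> V)" and "\<not> f {}" "growth_minimal V f"
  shows "decision_list V f"
  using assms
proof (induction "card V" arbitrary: V f)
  case 0
  then have "f = (\<lambda>_. False)" by auto
  then show ?case by (simp add: dl_zero)
next
  case (Suc n V f)
  note V = Suc.prems(1) and mono = Suc.prems(2) and loc = Suc.prems(3) and f0 = Suc.prems(4) and gm = Suc.prems(5)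
  \<comment> \<open>On monomials free of \<open>x\<close> the deletion is \<open>f\<close> itself;
    dropping \<open>x\<close> from the argument makes the predicate depend on \<open>V - {x}\<close>
    only, as the induction hypothesis requires.\<close>
  define del where "del x = (\<lambda>A. f (A - {x}))" for x
  define link where "link x = (\<lambda>A. f (insert x A))" for x
  have del: "decision_list (V - {x}) (del x)" if x: "x \<in> V" for x
  proof (rule Suc.hyps(1))
    have "supp u - {x} = supp u" if "u \<in> Mon (V - {x}) d" for u d
      using that by (auto simp: Mon_def)
    then have "ideal_part (V - {x}) (del x) d = ideal_part (V - {x}) f d" for d
      unfolding ideal_part_def del_def by auto
    then show "growth_minimal (V - {x}) (del x)"
      using growth_minimal_delete[OF V x gm] by (simp add: growth_minimal_def)
    show "del x A = del x (A \<inter> (V - {x}))" for A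
      unfolding del_def using loc[of "A - {x}"] loc[of "A \<inter> (V - {x}) - {x}"]
      by (metis (no_types, lifting) Diff_Int_distrib2 Diff_idemp Int_Diff inf.right_idem inf_commute)
    show "del x B" if "A \<subseteq> B" "del x A" for A B
      using that mono[of "A - {x}" "B - {x}"] by (auto simp: del_def)
  qed (use V x Suc.hyps(2) f0 in \<open>auto simp: del_def\<close>)
  have link: "decision_list (V - {x}) (link x)" if x: "x \<in> V" "\<not> f {x}" for x
  proof (rule Suc.hyps(1))
    show "growth_minimal (V - {x}) (link x)"
      unfolding link_def by (rule growth_minimal_link[OF V x(1) gm mono x(2)])
    show "link x A = link x (A \<inter> (V - {x}))" for A
    proof -
      have "insert x A \<inter> V = insert x (A \<inter> (V - {x})) \<inter> V" by auto
      then show ?thesis unfolding link_def using loc by metis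
    qed
    show "link x B" if "A \<subseteq> B" "link x A" for A B
      using that mono[of "insert x A" "insert x B"] by (auto simp: link_def)
  qed (use V x Suc.hyps(2) in \<open>auto simp: link_def\<close>)
  consider "\<forall>A. \<not> f A" | x where "x \<in> V" "f {x}" | x where "x \<in> V" "\<not> f {x}" "\<forall>A. f A \<longrightarrow> x \<in> A"
    | "\<exists>A. f A" "\<forall>x\<in>V. \<not> f {x}" "\<forall>x\<in>V. \<exists>A. f A \<and> x \<notin> A"
    by blast
  then show ?case
  proof cases
    case 1
    then have "f = (\<lambda>_. False)" by auto
    then show ?thesis by (simp add: dl_zero)
  next
    case 2
    have "f = (\<lambda>A. x \<in> A \<or> del x A)"
    proof
      fix A
      show "f A = (x \<in> A \<or> del x A)"
        using mono[of "{x}" A] 2 by (cases "x \<in> A") (simp_all add: del_def)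
    qed
    moreover have "decision_list (insert x (V - {x})) (\<lambda>A. x \<in> A \<or> del x A)"
      by (rule dl_disj[OF del[OF 2(1)]]) simp
    ultimately show ?thesis using insert_Diff[OF 2(1)] by metis
  next
    case 3
    have "f = (\<lambda>A. x \<in> A \<and> link x A)"
    proof
      fix A
      show "f A = (x \<in> A \<and> link x A)"
      proof (cases "x \<in> A")
        case True
        then show ?thesis unfolding link_def by (simp only: insert_absorb simp_thms)
      next
        case False
        then show ?thesis using 3(3) by blast
      qed
    qed
    moreover have "decision_list (insert x (V - {x})) (\<lambda>A. x \<in> A \<and> link x A)"
      by (rule dl_conj[OF link[OF 3(1,2)]]) simp
    ultimately show ?thesis using insert_Diff[OF 3(1)] by metis
  next
    case 4
    obtain A0 where A0: "f A0" using 4(1) by blast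
    have "V \<noteq> {}" using Suc.hyps(2) by auto
    \<comment> \<open>The deletion is nonzero because some member of the ideal avoids
      \<open>x\<close>, and it contains no variable; its outermost step must therefore be a factor
      \<open>y\<close>.\<close>
    have P1: "\<exists>y\<in>V - {x}. \<forall>A. f A \<longrightarrow> x \<in> A \<or> y \<in> A" if x: "x \<in> V" for x
    proof -
      obtain A where "f A" "x \<notin> A" using 4(3) x by blast
      then have "\<not> (\<forall>A. \<not> del x A)" unfolding del_def by (metis Diff_empty Diff_insert0)
      moreover have "\<not> del x {y}" if "y \<in> V - {x}" for y using 4(2) that by (simp add: del_def)
      ultimately obtain y where y: "y \<in> V - {x}" "\<forall>A. del x A \<longrightarrow> y \<in> A"
        using decision_list_cases[OF del[OF x]] by blast
      have "x \<in> A \<or> y \<in> A" if "f A" for A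
        using that y(2)[rule_format, of A] by (cases "x \<in> A") (auto simp: del_def)
      then show ?thesis using y by blast
    qed
    \<comment> \<open>The link contains the ideal, so it is nonzero and a common factor of the link
      would divide the whole ideal; its outermost step must add a variable.\<close>
    have P2: "\<exists>z\<in>V - {x}. f {x, z}" if x: "x \<in> V" for x
    proof -
      have imp: "link x A" if "f A" for A using that mono[of A "insert x A"] by (auto simp: link_def)
      have "\<exists>y\<in>V - {x}. link x {y}"
        using decision_list_cases[OF link[OF x]] 4(2,3) x imp A0 by blast
      then show ?thesis by (auto simp: link_def)
    qed
    have "\<not> growth_minimal V f"
      by (rule not_growth_minimal_two_covers[OF V \<open>V \<noteq> {}\<close> mono _ f0 _ P1 P2]) (use loc 4 in blast)+
    then show ?thesis using gm by simp
  qed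
qed

section \<open>From polynomials to monomials\<close>

abbreviation terms :: "'k::zero mpoly \<Rightarrow> (nat \<Rightarrow>\<^sub>0 nat) set" where
  "terms \<equiv> Poly_Mapping.keys"

abbreviation coef :: "'k::zero mpoly \<Rightarrow> (nat \<Rightarrow>\<^sub>0 nat) \<Rightarrow> 'k" where
  "coef \<equiv> Poly_Mapping.lookup"

lemma poly_sum_terms: "(p :: 'k::field mpoly) = (\<Sum>u\<in>terms p. Poly_Mapping.single u (coef p u))"
proof (rule poly_mapping_eqI)
  fix v
  have "(\<Sum>u\<in>terms p. coef (Poly_Mapping.single u (coef p u)) v) = (\<Sum>u\<in>terms p. if u = v then coef p u else 0)"
    by (intro sum.cong) (auto simp: lookup_single when_def)
  also have "\<dots> = coef p v" by (simp add: in_keys_iff)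
  finally show "coef p v = coef (\<Sum>u\<in>terms p. Poly_Mapping.single u (coef p u)) v"
    by (simp add: lookup_sum)
qed

lemma coef_smul: "coef (smul c p) u = c * coef p u"
  unfolding smul_def mult_map_scale_conv_mult[symmetric]
  by (simp add: map.rep_eq when_def)

lemma coef_monom: "coef (monom t :: 'k::field mpoly) u = (if u = t then 1 else 0)"
  by (auto simp: monom_def lookup_single when_def)

lemma terms_monom [simp]: "terms (monom t :: 'k::field mpoly) = {t}"
  by (simp add: monom_def)

lemma monom_mult: "monom s * monom t = (monom (s + t) :: 'k::field mpoly)"
  by (simp add: monom_def mult_single)

lemma coef_monom_mult: "coef (monom t * p) (u + t) = coef (p :: 'k::field mpoly) u"
proof -
  have "monom t * p = (\<Sum>v\<in>terms p. monom t * Poly_Mapping.single v (coef p v))"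
    by (subst poly_sum_terms[of p]) (rule sum_distrib_left)
  then have "coef (monom t * p) (u + t) = (\<Sum>v\<in>terms p. coef (Poly_Mapping.single (t + v) (coef p v)) (u + t))"
    by (simp add: monom_def mult_single lookup_sum)
  also have "\<dots> = (\<Sum>v\<in>terms p. if v = u then coef p v else 0)"
    by (intro sum.cong) (auto simp: lookup_single when_def add.commute[of t])
  also have "\<dots> = coef p u" by (simp add: in_keys_iff)
  finally show ?thesis .
qed

lemma terms_monom_mult: "terms (monom t * p) = (\<lambda>u. u + t) ` terms (p :: 'k::field mpoly)"
proof
  show "terms (monom t * p) \<subseteq> (\<lambda>u. u + t) ` terms p"
    using keys_mult[of "monom t" p] by (auto simp: add.commute)
  show "(\<lambda>u. u + t) ` terms p \<subseteq> terms (monom t * p)"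
    by (auto simp: in_keys_iff coef_monom_mult)
qed

lemma terms_var_mult: "terms (var j * p) = (\<lambda>u. u + X j) ` terms (p :: 'k::field mpoly)"
  by (simp add: var_def terms_monom_mult)

interpretation mp: vector_space "smul :: 'k::field \<Rightarrow> 'k mpoly \<Rightarrow> 'k mpoly"
  by unfold_locales (auto intro!: poly_mapping_eqI simp: coef_smul lookup_add algebra_simps)

section \<open>Leading monomials and dimension\<close>

definition lm :: "'k::field mpoly \<Rightarrow> (nat \<Rightarrow>\<^sub>0 nat)" where
  "lm p = Max (terms p)"

lemma lm_in_terms: "p \<noteq> 0 \<Longrightarrow> lm p \<in> terms p"
  by (simp add: lm_def)

lemma coef_lm: "p \<noteq> 0 \<Longrightarrow> coef p (lm p) \<noteq> 0"
  using lm_in_terms by (auto simp: in_keys_iff)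

lemma le_lm: "u \<in> terms p \<Longrightarrow> u \<le> lm p"
  by (simp add: lm_def)

lemma coef_above_lm: "lm p < u \<Longrightarrow> coef p u = 0"
proof (rule ccontr)
  assume "lm p < u" "coef p u \<noteq> 0"
  then show False using le_lm[of u p] by (simp add: in_keys_iff)
qed

lemma lm_var_mult:
  assumes "p \<noteq> 0"
  shows "lm (var j * p) = lm p + X j" "var j * p \<noteq> 0"
proof -
  have ne: "terms p \<noteq> {}" using assms by simp
  show "lm (var j * p) = lm p + X j"
    unfolding lm_def terms_var_mult
    by (rule Max_eqI) (use ne in \<open>auto intro: add_right_mono Max_ge\<close>)
  show "var j * p \<noteq> 0"
    using ne terms_var_mult[of j p] by (metis image_is_empty keys_zero)
qed

lemma lm_monom [simp]: "lm (monom t :: 'k::field mpoly) = t"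
  by (simp add: lm_def)

text \<open>In a nontrivial relation the largest leading monomial among the elements actually
  involved occurs in one of them only and cannot cancel.\<close>

lemma independent_if_inj_lm:
  assumes "0 \<notin> B" "inj_on lm B"
  shows "mp.independent B"
proof
  assume "mp.dependent B"
  then obtain T c where T: "finite T" "T \<subseteq> B" "\<exists>v\<in>T. c v \<noteq> 0" "(\<Sum>v\<in>T. smul (c v) v) = 0"
    unfolding mp.dependent_explicit by blast
  define T' where "T' = {v \<in> T. c v \<noteq> 0}"
  have T': "finite T'" "T' \<noteq> {}" using T by (auto simp: T'_def)
  then have "Max (lm ` T') \<in> lm ` T'" by (intro Max_in) auto
  then obtain b where b: "b \<in> T'" "lm b = Max (lm ` T')" by auto
  have zero: "coef v (lm b) = 0" if "v \<in> T'" "v \<noteq> b" for v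
  proof (rule coef_above_lm)
    have "lm v \<le> lm b" using that T' b by simp
    moreover have "lm v \<noteq> lm b" using inj_onD[OF assms(2), of v b] that b T by (auto simp: T'_def)
    ultimately show "lm v < lm b" by simp
  qed
  have "0 = coef (\<Sum>v\<in>T. smul (c v) v) (lm b)" using T by simp
  also have "\<dots> = (\<Sum>v\<in>T. c v * coef v (lm b))" by (simp add: lookup_sum coef_smul)
  also have "\<dots> = (\<Sum>v\<in>{b}. c v * coef v (lm b))"
    using T(1) b(1) zero by (intro sum.mono_neutral_right) (auto simp: T'_def)
  finally have "coef b (lm b) = 0" using b by (simp add: T'_def)
  then show False using coef_lm[of b] assms(1) b T by (auto simp: T'_def)
qed

lemma span_monoms:
  assumes "terms p \<subseteq> U"
  shows "(p :: 'k::field mpoly) \<in> mp.span (monom ` U)"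
proof -
  have "Poly_Mapping.single u c = smul c (monom u)" for u and c :: 'k
    by (rule poly_mapping_eqI) (auto simp: coef_smul coef_monom lookup_single when_def)
  then have "p = (\<Sum>u\<in>terms p. smul (coef p u) (monom u))"
    using poly_sum_terms[of p] by simp
  also have "\<dots> \<in> mp.span (monom ` U)"
    using assms by (intro mp.span_sum mp.span_scale mp.span_base) auto
  finally show ?thesis .
qed

lemma dim_le_card_monoms:
  assumes "finite U" "\<And>p. p \<in> W \<Longrightarrow> terms p \<subseteq> U"
  shows "kdim (W :: 'k::field mpoly set) \<le> card U"
proof -
  have "mp.dim W \<le> card (monom ` U :: 'k mpoly set)"
    using assms by (intro mp.dim_le_card subsetI span_monoms finite_imageI) auto
  also have "\<dots> \<le> card U" using assms by (intro card_image_le)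
  finally show ?thesis by (simp add: kdim_def)
qed

text \<open>\<open>W\<close> is an arbitrary set because \<open>m1\<close> provides only generators
  of its span. One polynomial per leading monomial gives an independent family.\<close>

lemma card_lm_le_dim:
  fixes W :: "'k::field mpoly set"
  assumes U: "finite U" "\<And>p. p \<in> W \<Longrightarrow> terms p \<subseteq> U" and L: "L \<subseteq> lm ` (W - {0})"
  shows "card L \<le> kdim W"
proof -
  obtain B where B: "B \<subseteq> W" "mp.independent B" "W \<subseteq> mp.span B" "card B = mp.dim W"
    using mp.basis_exists by blast
  have finB: "finite B"
    using mp.independent_span_bound[of "monom ` U" B] U B span_monoms by blast
  define q where "q u = (SOME p. p \<in> W - {0} \<and> lm p = u)" for u
  have q: "q u \<in> W - {0}" "lm (q u) = u" if "u \<in> L" for u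
    using someI_ex[of "\<lambda>p. p \<in> W - {0} \<and> lm p = u"] L that unfolding q_def by blast+
  have "inj_on lm (q ` L)" using q by (auto simp: inj_on_def)
  then have "mp.independent (q ` L)" using q by (intro independent_if_inj_lm) auto
  then have "card (q ` L) \<le> card B"
    using mp.independent_span_bound[OF finB] q B by blast
  moreover have "card (q ` L) = card L" using q by (intro card_image) (metis inj_onI)
  ultimately show ?thesis using B by (simp add: kdim_def)
qed

text \<open>Elimination: subtracting a multiple of the chosen polynomial with the same leading
  monomial stays in the subspace and lowers the leading monomial, so the chosen polynomials
  span.\<close>

lemma dim_eq_card_lm:
  fixes W :: "'k::field mpoly set"
  assumes U: "finite U" "\<And>p. p \<in> W \<Longrightarrow> terms p \<subseteq> U" and sub: "mp.subspace W"
  shows "kdim W = card (lm ` (W - {0}))"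
proof (rule antisym)
  show "card (lm ` (W - {0})) \<le> kdim W"
    by (rule card_lm_le_dim[OF U]) auto
  define L where "L = lm ` (W - {0})"
  have "L \<subseteq> U" using U lm_in_terms by (fastforce simp: L_def)
  then have finL: "finite L" using U finite_subset by blast
  define q where "q u = (SOME p. p \<in> W - {0} \<and> lm p = u)" for u
  have q: "q u \<in> W - {0}" "lm (q u) = u" if "u \<in> L" for u
    using someI_ex[of "\<lambda>p. p \<in> W - {0} \<and> lm p = u"] that unfolding q_def L_def by blast+
  have span: "p \<in> mp.span (q ` L)" if "p \<in> W" for p
    using that
  proof (induction "card {u \<in> L. u \<le> lm p}" arbitrary: p rule: less_induct)
    case less
    show ?case
    proof (cases "p = 0")
      case True
      then show ?thesis by (simp add: mp.span_zero)
    next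
      case False
      let ?u = "lm p"
      have u: "?u \<in> L" using less.prems False by (auto simp: L_def)
      define c where "c = coef p ?u / coef (q ?u) ?u"
      define r where "r = p - smul c (q ?u)"
      have rW: "r \<in> W" unfolding r_def
        using sub less.prems q[OF u] by (intro mp.subspace_diff mp.subspace_scale) auto
      have qu: "coef (q ?u) ?u \<noteq> 0" using coef_lm[of "q ?u"] q[OF u] by auto
      have coef_r: "coef r v = coef p v - c * coef (q ?u) v" for v
        by (simp add: r_def lookup_minus coef_smul)
      have "r \<in> mp.span (q ` L)"
      proof (cases "r = 0")
        case True
        then show ?thesis by (simp add: mp.span_zero)
      next
        case False
        have "coef r ?u = 0" using qu by (simp add: coef_r c_def)
        moreover have "coef r v = 0" if "?u < v" for v
          using coef_above_lm[of p v] coef_above_lm[of "q ?u" v] q(2)[OF u] that by (simp add: coef_r)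
        ultimately have "lm r < ?u" using coef_lm[OF False] by (metis linorder_neqE)
        then have "?u \<notin> {u \<in> L. u \<le> lm r}" "{u \<in> L. u \<le> lm r} \<subseteq> {u \<in> L. u \<le> lm p}" by auto
        then have "{u \<in> L. u \<le> lm r} \<subset> {u \<in> L. u \<le> lm p}" using u by blast
        then have "card {u \<in> L. u \<le> lm r} < card {u \<in> L. u \<le> lm p}"
          using finL by (intro psubset_card_mono) auto
        then show ?thesis using less.hyps rW by blast
      qed
      moreover have "smul c (q ?u) \<in> mp.span (q ` L)" using u by (intro mp.span_scale mp.span_base) auto
      moreover have "p = r + smul c (q ?u)" by (simp add: r_def)
      ultimately show ?thesis using mp.span_add by metis
    qed
  qed
  have "mp.dim W \<le> card (q ` L)" using span finL by (intro mp.dim_le_card) auto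
  also have "\<dots> \<le> card L" using finL by (rule card_image_le)
  finally show "kdim W \<le> card (lm ` (W - {0}))" by (simp add: kdim_def L_def)
qed

lemma dim_monomial_space:
  assumes "finite U"
  shows "kdim {p :: 'k::field mpoly. terms p \<subseteq> U} = card U"
proof (rule antisym)
  have "lm (monom u :: 'k mpoly) = u \<and> (monom u :: 'k mpoly) \<noteq> 0 \<and> terms (monom u :: 'k mpoly) = {u}" for u
    using terms_monom[of u, where 'k='k] by (metis insert_not_empty keys_zero lm_monom)
  then have "U \<subseteq> lm ` ({p :: 'k mpoly. terms p \<subseteq> U} - {0})"
    by (force intro!: image_eqI[where x = "monom _"])
  then show "card U \<le> kdim {p :: 'k mpoly. terms p \<subseteq> U}"
    by (intro card_lm_le_dim[OF assms]) auto
qed (rule dim_le_card_monoms[OF assms], simp)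

text \<open>Taking leading monomials commutes with multiplication by a variable. Only an inequality
  holds, since cancellation in the span may create further leading monomials.\<close>

lemma card_shadow_le_dim_m1:
  fixes W :: "'k::field mpoly set"
  assumes W: "\<And>p. p \<in> W \<Longrightarrow> terms p \<subseteq> Mon {..<n} d"
  shows "card (shadow {..<n} (lm ` (W - {0}))) \<le> kdim (m1 n W)"
proof (rule card_lm_le_dim)
  show "finite (Mon {..<n} (Suc d))" by simp
  show "terms p \<subseteq> Mon {..<n} (Suc d)" if "p \<in> m1 n W" for p
    using that W by (fastforce simp: m1_def terms_var_mult intro: Mon_add_X)
  show "shadow {..<n} (lm ` (W - {0})) \<subseteq> lm ` (m1 n W - {0})"
  proof
    fix s assume "s \<in> shadow {..<n} (lm ` (W - {0}))"
    then obtain p j where p: "p \<in> W" "p \<noteq> 0" "j < n" "s = lm p + X j" by (auto simp: shadow_def)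
    then have "s = lm (var j * p)" "var j * p \<in> m1 n W - {0}"
      using lm_var_mult[of p j] by (auto simp: m1_def)
    then show "s \<in> lm ` (m1 n W - {0})" by blast
  qed
qed

lemma dim_m1_monomial_space:
  assumes "M \<subseteq> Mon {..<n} d"
  shows "kdim (m1 n {p :: 'k::field mpoly. terms p \<subseteq> M}) = card (shadow {..<n} M)"
proof (rule antisym)
  let ?W = "{p :: 'k mpoly. terms p \<subseteq> M}"
  show "kdim (m1 n ?W) \<le> card (shadow {..<n} M)"
  proof (rule dim_le_card_monoms[OF finite_shadow[OF _ assms]])
    fix p assume "p \<in> m1 n ?W"
    then obtain j q where q: "p = var j * q" "j < n" "terms q \<subseteq> M" by (auto simp: m1_def)
    then have "u + X j \<in> shadow {..<n} M" if "u \<in> terms q" for u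
      using that unfolding shadow_def by blast
    then show "terms p \<subseteq> shadow {..<n} M" unfolding q(1) terms_var_mult by blast
  qed simp
  have "M \<subseteq> lm ` (?W - {0})"
  proof
    fix u assume "u \<in> M"
    moreover have "(monom u :: 'k mpoly) \<noteq> 0" using terms_monom by (metis insert_not_empty keys_zero)
    ultimately show "u \<in> lm ` (?W - {0})" by (intro image_eqI[of _ _ "monom u"]) auto
  qed
  then have "shadow {..<n} M \<subseteq> shadow {..<n} (lm ` (?W - {0}))" by (rule shadow_mono)
  moreover have "lm ` (?W - {0}) \<subseteq> Mon {..<n} d" using lm_in_terms assms by fastforce
  ultimately have "card (shadow {..<n} M) \<le> card (shadow {..<n} (lm ` (?W - {0})))"
    by (intro card_mono finite_shadow) auto
  also have "\<dots> \<le> kdim (m1 n ?W)"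
    by (rule card_shadow_le_dim_m1) (use assms in auto)
  finally show "card (shadow {..<n} M) \<le> kdim (m1 n ?W)" .
qed

section \<open>Ideals generated by monomials\<close>

definition multiples :: "nat \<Rightarrow> (nat \<Rightarrow>\<^sub>0 nat) set \<Rightarrow> 'k::field mpoly set" where
  "multiples n G = {p \<in> polyS n. \<forall>u\<in>terms p. \<exists>g\<in>G. mdvd g u}"

lemma mdvd_refl [simp]: "mdvd u u"
  by (simp add: mdvd_def)

lemma mdvd_trans: "mdvd u v \<Longrightarrow> mdvd v w \<Longrightarrow> mdvd u w"
  unfolding mdvd_def using order_trans by blast

lemma mdvd_add: "mdvd u v \<Longrightarrow> mdvd u (w + v)"
  by (auto simp: mdvd_def lookup_add intro: trans_le_add2)

lemma mdvd_obtain: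
  assumes "mdvd g u"
  obtains w where "u = w + g"
proof
  show "u = (u - g) + g"
    using assms by (intro poly_mapping_eqI) (auto simp: lookup_add lookup_minus mdvd_def)
qed

lemma mdvd_mdeg_eq:
  assumes "mdvd g u" "mdeg g = mdeg u"
  shows "g = u"
proof -
  obtain w where "u = w + g" using mdvd_obtain[OF assms(1)] .
  then show ?thesis using assms(2) mdeg_eq_0_iff[of w] by (simp add: mdeg_add)
qed

lemma mdvd_supp: "mdvd g u \<Longrightarrow> supp g \<subseteq> supp u"
  by (auto simp: mdvd_def in_keys_iff) (metis le_zero_eq neq0_conv)

lemma mdvd_sqfree_iff: "sqfree_mon g \<Longrightarrow> mdvd g u \<longleftrightarrow> supp g \<subseteq> supp u"
proof
  assume g: "sqfree_mon g" and sub: "supp g \<subseteq> supp u"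
  show "mdvd g u" unfolding mdvd_def
  proof
    fix i
    show "expo g i \<le> expo u i"
    proof (cases "i \<in> supp g")
      case True
      then have "expo g i \<le> 1" "0 < expo u i"
        using g subsetD[OF sub True] by (auto simp: sqfree_mon_def in_keys_iff)
      then show ?thesis by simp
    qed (simp add: in_keys_iff)
  qed
qed (rule mdvd_supp)

lemma polyS_add: "p \<in> polyS n \<Longrightarrow> q \<in> polyS n \<Longrightarrow> p + q \<in> polyS n"
  using keys_add[of p q] by (auto simp: polyS_def)

lemma polyS_mult: "p \<in> polyS n \<Longrightarrow> q \<in> polyS n \<Longrightarrow> p * q \<in> polyS n"
  using keys_mult[of p q] by (fastforce simp: polyS_def supp_add)

lemma monom_polyS_iff [simp]: "(monom u :: 'k::field mpoly) \<in> polyS n \<longleftrightarrow> supp u \<subseteq> {..<n}"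
  by (simp add: polyS_def)

lemma single_polyS: "supp u \<subseteq> {..<n} \<Longrightarrow> Poly_Mapping.single u c \<in> polyS n"
  by (auto simp: polyS_def)

lemma is_ideal_multiples: "is_ideal n (multiples n G :: 'k::field mpoly set)"
  unfolding is_ideal_def
proof (intro conjI ballI)
  show "multiples n G \<subseteq> (polyS n :: 'k mpoly set)" by (auto simp: multiples_def)
  show "(0 :: 'k mpoly) \<in> multiples n G" by (simp add: multiples_def polyS_def)
next
  fix p q :: "'k mpoly" assume "p \<in> multiples n G" "q \<in> multiples n G"
  then show "p + q \<in> multiples n G"
    using keys_add[of p q] by (auto simp: multiples_def intro: polyS_add)
next
  fix f p :: "'k mpoly" assume f: "f \<in> polyS n" and p: "p \<in> multiples n G"
  have "\<exists>g\<in>G. mdvd g u" if u: "u \<in> terms (f * p)" for u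
  proof -
    obtain a b where ab: "u = a + b" "b \<in> terms p" using keys_mult[of f p] u by blast
    then obtain g where "g \<in> G" "mdvd g b" using p by (auto simp: multiples_def)
    then show ?thesis using ab mdvd_add by blast
  qed
  then show "f * p \<in> multiples n G" using f p polyS_mult by (auto simp: multiples_def)
qed

lemma is_ideal_sum:
  assumes "is_ideal n J" "finite T" "\<And>x. x \<in> T \<Longrightarrow> h x \<in> J"
  shows "sum h T \<in> J"
  using assms(2,3) by (induction T) (use assms(1) in \<open>auto simp: is_ideal_def\<close>)

text \<open>Each term of a multiple is a single-term polynomial times a generator, hence lies in
  every ideal containing the generators.\<close>

lemma ideal_gen_monoms:
  assumes "\<And>g. g \<in> G \<Longrightarrow> supp g \<subseteq> {..<n}"
  shows "ideal_gen n (monom ` G) = (multiples n G :: 'k::field mpoly set)"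
proof
  have "\<exists>h\<in>G. mdvd h g" if "g \<in> G" for g using that mdvd_refl by blast
  then have "monom ` G \<subseteq> (multiples n G :: 'k mpoly set)" using assms by (auto simp: multiples_def)
  then show "ideal_gen n (monom ` G) \<subseteq> (multiples n G :: 'k mpoly set)"
    unfolding ideal_gen_def using is_ideal_multiples by blast
  show "multiples n G \<subseteq> (ideal_gen n (monom ` G) :: 'k mpoly set)"
  proof
    fix p :: "'k mpoly" assume p: "p \<in> multiples n G"
    have "p \<in> J" if J: "is_ideal n J" "monom ` G \<subseteq> J" for J
    proof -
      have "Poly_Mapping.single u (coef p u) \<in> J" if u: "u \<in> terms p" for u
      proof -
        obtain g where g: "g \<in> G" "mdvd g u" using p u by (auto simp: multiples_def)
        obtain w where w: "u = w + g" using mdvd_obtain[OF g(2)] .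
        have "supp u \<subseteq> {..<n}" using p u by (auto simp: multiples_def polyS_def)
        then have "Poly_Mapping.single w (coef p u) \<in> polyS n" using w by (intro single_polyS) (auto simp: supp_add)
        moreover have "Poly_Mapping.single u (coef p u) = Poly_Mapping.single w (coef p u) * monom g"
          by (simp add: w monom_def mult_single)
        ultimately show ?thesis using J g by (auto simp: is_ideal_def)
      qed
      then have "(\<Sum>u\<in>terms p. Poly_Mapping.single u (coef p u)) \<in> J"
        by (intro is_ideal_sum[OF J(1)]) auto
      then show ?thesis using poly_sum_terms[of p] by simp
    qed
    then show "p \<in> ideal_gen n (monom ` G)" by (auto simp: ideal_gen_def)
  qed
qed

lemma coef_hcomp: "coef (hcomp d p) u = (if mdeg u = d then coef p u else 0)"
proof -
  have "finite {u. (if mdeg u = d then coef p u else 0) \<noteq> 0}"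
    by (rule finite_subset[of _ "terms p"]) (auto simp: in_keys_iff)
  then show ?thesis unfolding hcomp_def by (subst lookup_Abs_poly_mapping) auto
qed

lemma terms_hcomp: "terms (hcomp d p) \<subseteq> terms p"
  by (auto simp: in_keys_iff coef_hcomp split: if_splits)

lemma homog_ideal_multiples: "homog_ideal n (multiples n G :: 'k::field mpoly set)"
  unfolding homog_ideal_def
proof (intro conjI ballI allI)
  fix p :: "'k mpoly" and d assume "p \<in> multiples n G"
  then show "hcomp d p \<in> multiples n G"
    using terms_hcomp[of d p] unfolding multiples_def polyS_def by blast
qed (rule is_ideal_multiples)

text \<open>A generator dividing a monomial of its own degree equals it, so passing to the ideal
  adds nothing in degree \<open>d\<close>.\<close>

lemma comp_multiples:
  assumes "L \<subseteq> Mon {..<n} d"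
  shows "comp (multiples n L) d = {p :: 'k::field mpoly. terms p \<subseteq> L}"
proof
  show "comp (multiples n L) d \<subseteq> {p :: 'k mpoly. terms p \<subseteq> L}"
  proof
    fix p :: "'k mpoly" assume p: "p \<in> comp (multiples n L) d"
    have "u \<in> L" if "u \<in> terms p" for u
    proof -
      obtain g where g: "g \<in> L" "mdvd g u" using p \<open>u \<in> _\<close> by (auto simp: multiples_def comp_def)
      then have "mdeg g = mdeg u" using assms p \<open>u \<in> _\<close> by (auto simp: Mon_def comp_def)
      then show ?thesis using g mdvd_mdeg_eq by blast
    qed
    then show "p \<in> {p. terms p \<subseteq> L}" by blast
  qed
  show "{p :: 'k mpoly. terms p \<subseteq> L} \<subseteq> comp (multiples n L) d"
  proof
    fix p :: "'k mpoly" assume p: "p \<in> {p. terms p \<subseteq> L}"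
    then have "supp u \<subseteq> {..<n} \<and> mdeg u = d \<and> (\<exists>g\<in>L. mdvd g u)" if "u \<in> terms p" for u
    proof -
      have "u \<in> L" using p that by blast
      moreover from this have "\<exists>g\<in>L. mdvd g u" using mdvd_refl by blast
      ultimately show ?thesis using assms by (auto simp: Mon_def)
    qed
    then show "p \<in> comp (multiples n L) d" by (simp add: comp_def multiples_def polyS_def)
  qed
qed

section \<open>Squarefree ideals and the Gotzmann property\<close>

definition sf_ideal :: "nat \<Rightarrow> (nat set \<Rightarrow> bool) \<Rightarrow> 'k::field mpoly set" where
  "sf_ideal n f = {p \<in> polyS n. \<forall>u\<in>terms p. f (supp u)}"

lemma comp_sf_ideal: "comp (sf_ideal n f) d = {p :: 'k::field mpoly. terms p \<subseteq> ideal_part {..<n} f d}"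
  by (auto simp: comp_def sf_ideal_def ideal_part_def Mon_def polyS_def)

lemma subspace_comp:
  assumes "is_ideal n (J :: 'k::field mpoly set)"
  shows "mp.subspace (comp J d)"
proof (rule mp.subspaceI)
  show "0 \<in> comp J d" using assms by (auto simp: is_ideal_def comp_def)
  show "x + y \<in> comp J d" if "x \<in> comp J d" "y \<in> comp J d" for x y
    using that assms keys_add[of x y] by (auto simp: is_ideal_def comp_def)
  show "smul c x \<in> comp J d" if "x \<in> comp J d" for c x
  proof -
    have "Poly_Mapping.single 0 c \<in> polyS n" by (auto simp: polyS_def)
    then have "smul c x \<in> J" using that assms by (auto simp: smul_def is_ideal_def comp_def)
    moreover have "terms (smul c x) \<subseteq> terms x" by (auto simp: in_keys_iff coef_smul)
    ultimately show ?thesis using that by (auto simp: comp_def)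
  qed
qed

text \<open>For an arbitrary \<open>J\<close> the leading monomials of its degree \<open>d\<close>
  part record the dimension exactly and bound the growth from below, where \<open>macaulay\<close>
  applies. In the other direction the ideal generated by a lex segment is the competitor.\<close>

theorem gotzmann_sf_ideal:
  "gotzmann n (sf_ideal n f :: 'k::field mpoly set) \<longleftrightarrow> growth_minimal {..<n} f"
proof
  assume gm: "growth_minimal {..<n} f"
  show "gotzmann n (sf_ideal n f :: 'k mpoly set)" unfolding gotzmann_def
  proof (intro allI impI)
    fix d and J :: "'k mpoly set"
    assume J: "homog_ideal n J \<and> kdim (comp J d) = kdim (comp (sf_ideal n f :: 'k mpoly set) d)"
    let ?M = "ideal_part {..<n} f d" and ?L = "lm ` (comp J d - {0})"
    have W: "terms p \<subseteq> Mon {..<n} d" if "p \<in> comp J d" for p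
    proof -
      have "p \<in> polyS n" "\<forall>u\<in>terms p. mdeg u = d"
        using that J by (auto simp: homog_ideal_def is_ideal_def comp_def)
      then show ?thesis by (auto simp: polyS_def Mon_def)
    qed
    have "is_ideal n J" using J by (simp add: homog_ideal_def)
    then have "card ?L = kdim (comp J d)"
      by (intro dim_eq_card_lm[symmetric, of "Mon {..<n} d"] subspace_comp W) auto
    also have "\<dots> = card ?M" using J
      by (simp add: comp_sf_ideal dim_monomial_space finite_ideal_part)
    finally have c: "card ?L = card ?M" .
    have "kdim (m1 n (comp (sf_ideal n f :: 'k mpoly set) d)) = card (shadow {..<n} ?M)"
      unfolding comp_sf_ideal by (rule dim_m1_monomial_space[OF ideal_part_subset])
    also have "\<dots> = lex_growth n d (card ?L)" using gm c by (simp add: growth_minimal_def)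
    also have "\<dots> \<le> card (shadow {..<n} ?L)"
      using macaulay[of "{..<n}" ?L d] W lm_in_terms by fastforce
    also have "\<dots> \<le> kdim (m1 n (comp J d))" by (rule card_shadow_le_dim_m1[OF W])
    finally show "kdim (m1 n (comp (sf_ideal n f :: 'k mpoly set) d)) \<le> kdim (m1 n (comp J d))" .
  qed
next
  assume G: "gotzmann n (sf_ideal n f :: 'k mpoly set)"
  show "growth_minimal {..<n} f" unfolding growth_minimal_def
  proof
    fix d
    let ?M = "ideal_part {..<n} f d"
    have le: "card ?M \<le> card (Mon {..<n} d)" by (intro card_mono ideal_part_subset) simp
    define L where "L = lseg {..<n} d (card ?M)"
    have L: "lexseg {..<n} d L" "card L = card ?M"
      using lexseg_lseg[OF _ le] card_lseg[OF _ le] by (auto simp: L_def)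
    then have LM: "L \<subseteq> Mon {..<n} d" by (simp add: lexseg_def)
    then have finL: "finite L" using finite_subset by fastforce
    let ?J = "multiples n L :: 'k mpoly set"
    have "kdim (comp ?J d) = kdim (comp (sf_ideal n f :: 'k mpoly set) d)"
      by (simp add: comp_multiples[OF LM] comp_sf_ideal dim_monomial_space finL finite_ideal_part L)
    then have "kdim (m1 n (comp (sf_ideal n f :: 'k mpoly set) d)) \<le> kdim (m1 n (comp ?J d))"
      using G homog_ideal_multiples unfolding gotzmann_def by blast
    then have "card (shadow {..<n} ?M) \<le> card (shadow {..<n} L)"
      by (simp add: comp_multiples[OF LM] comp_sf_ideal dim_m1_monomial_space[OF LM]
          dim_m1_monomial_space[OF ideal_part_subset])
    also have "\<dots> = lex_growth (card {..<n}) d (card ?M)"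
      using card_shadow_lexseg[OF _ L(1)] L(2) by simp
    finally show "card (shadow {..<n} ?M) = lex_growth (card {..<n}) d (card ?M)"
      using macaulay[of "{..<n}" ?M d] ideal_part_subset[of "{..<n}" f d] by simp
  qed
qed

text \<open>\<open>f\<close> is read off the minimal generators, as only these are assumed
  squarefree; descent on the degree finds one below every monomial of the ideal. Properness gives
  \<open>\<not> f {}\<close>, since otherwise 1 would be a generator.\<close>

lemma sqfree_monomial_idealE:
  fixes I :: "'k::field mpoly set"
  assumes "sqfree_monomial_ideal n I" "I \<noteq> polyS n"
  obtains f where "I = sf_ideal n f" "\<And>A B. A \<subseteq> B \<Longrightarrow> f A \<Longrightarrow> f B" "\<And>A. f A \<longleftrightarrow> f (A \<inter> {..<n})" "\<not> f {}"
proof -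
  obtain G where G: "\<forall>u\<in>G. supp u \<subseteq> {..<n}" "I = ideal_gen n (monom ` G)" and ideal: "is_ideal n I"
    using assms(1) by (auto simp: sqfree_monomial_ideal_def monomial_ideal_def)
  then have I: "I = multiples n G" using ideal_gen_monoms[of G n] by auto
  have monI: "monom u \<in> I \<longleftrightarrow> supp u \<subseteq> {..<n} \<and> (\<exists>g\<in>G. mdvd g u)" for u
    by (simp add: I multiples_def)
  define f where "f A \<longleftrightarrow> (\<exists>v. min_mon_gen n I v \<and> supp v \<subseteq> A)" for A
  have gen: "\<exists>v. min_mon_gen n I v \<and> mdvd v u" if "monom u \<in> I" for u
    using that
  proof (induction "mdeg u" arbitrary: u rule: less_induct)
    case less
    show ?case
    proof (cases "min_mon_gen n I u")
      case False
      moreover have "supp u \<subseteq> {..<n}" using less.prems monI by blast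
      ultimately obtain v where v: "monom v \<in> I" "mdvd v u" "v \<noteq> u"
        using less.prems by (auto simp: min_mon_gen_def)
      obtain w where w: "u = w + v" using mdvd_obtain[OF v(2)] .
      then have "w \<noteq> 0" using v(3) by auto
      then have "mdeg v < mdeg u" using w mdeg_eq_0_iff[of w] by (simp add: mdeg_add)
      then show ?thesis using less.hyps v mdvd_trans by blast
    qed (auto intro: mdvd_refl)
  qed
  have "I = sf_ideal n f"
  proof
    show "I \<subseteq> sf_ideal n f"
    proof
      fix p assume p: "p \<in> I"
      have "f (supp u)" if u: "u \<in> terms p" for u
      proof -
        have "monom u \<in> I" using p u by (auto simp: monI I multiples_def polyS_def)
        then obtain v where "min_mon_gen n I v" "mdvd v u" using gen by blast
        then show ?thesis using mdvd_supp by (auto simp: f_def)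
      qed
      then show "p \<in> sf_ideal n f" using p by (auto simp: sf_ideal_def I multiples_def)
    qed
    show "sf_ideal n f \<subseteq> I"
    proof
      fix p :: "'k mpoly" assume p: "p \<in> sf_ideal n f"
      have "\<exists>g\<in>G. mdvd g u" if u: "u \<in> terms p" for u
      proof -
        obtain v where v: "min_mon_gen n I v" "supp v \<subseteq> supp u" using p u by (auto simp: sf_ideal_def f_def)
        then have "sqfree_mon v" "monom v \<in> I"
          using assms(1) by (auto simp: sqfree_monomial_ideal_def min_mon_gen_def)
        then show ?thesis using v monI mdvd_sqfree_iff mdvd_trans by blast
      qed
      then show "p \<in> I" using p by (auto simp: I multiples_def sf_ideal_def)
    qed
  qed
  moreover have "f B" if "A \<subseteq> B" "f A" for A B using that by (auto simp: f_def)
  moreover have "f A \<longleftrightarrow> f (A \<inter> {..<n})" for A by (auto simp: f_def min_mon_gen_def)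
  moreover have "\<not> f {}"
  proof
    assume "f {}"
    then have "(monom 0 :: 'k mpoly) \<in> I" by (auto simp: f_def min_mon_gen_def)
    then have "p \<in> I" if "p \<in> polyS n" for p
      using ideal that unfolding is_ideal_def by (metis monom_def mult.right_neutral single_one)
    then show False using assms(2) ideal by (auto simp: is_ideal_def)
  qed
  ultimately show ?thesis using that by blast
qed

text \<open>The squarefree ideal of \<open>m\<^sub>1(R\<^sub>1) + m\<^sub>1m\<^sub>2(R\<^sub>2) + \<cdots>\<close> in the nested form
  \<open>m\<^sub>1((R\<^sub>1) + m\<^sub>2((R\<^sub>2) + \<cdots>))\<close>.\<close>

fun nested :: "((nat \<Rightarrow>\<^sub>0 nat) \<times> nat set) list \<Rightarrow> nat set \<Rightarrow> bool" where
  "nested [] A \<longleftrightarrow> False"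
| "nested (mR # L) A \<longleftrightarrow> supp (fst mR) \<subseteq> A \<and> (snd mR \<inter> A \<noteq> {} \<or> nested L A)"

text \<open>Unrolling the nesting collects the prefix products, written additively; counting from 0,
  block \<open>j\<close> carries the first \<open>j + 1\<close> factors.\<close>

lemma nested_iff:
  "nested L A \<longleftrightarrow> (\<exists>j<length L. \<exists>i\<in>snd (L ! j). supp ((\<Sum>l\<le>j. fst (L ! l)) + X i) \<subseteq> A)"
proof (induction L)
  case (Cons mR L)
  then show ?case
    by (auto simp: Ex_less_Suc2 sum.atMost_Suc_shift supp_add simp del: sum.atMost_Suc)
qed simp

section \<open>Lists with disjoint supports and decision lists\<close>

definition disjoint_supports :: "((nat \<Rightarrow>\<^sub>0 nat) \<times> nat set) list \<Rightarrow> bool" where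
  "disjoint_supports L \<longleftrightarrow>
     (\<forall>j < length L. sqfree_mon (fst (L ! j))) \<and>
     (\<forall>j < length L. \<forall>k < length L. j \<noteq> k \<longrightarrow>
        supp (fst (L ! j)) \<inter> supp (fst (L ! k)) = {} \<and> snd (L ! j) \<inter> snd (L ! k) = {}) \<and>
     (\<forall>j < length L. \<forall>k < length L. supp (fst (L ! j)) \<inter> snd (L ! k) = {})"

definition parts :: "(nat \<Rightarrow>\<^sub>0 nat) \<times> nat set \<Rightarrow> nat set" where
  "parts a = supp (fst a) \<union> snd a"

text \<open>The clauses mix conditions within one pair and between different pairs; collecting the
  variables of a pair in \<open>parts\<close> separates them and yields a rule for
  \<open>Cons\<close>.\<close>

lemma disjoint_supports_alt:
  "disjoint_supports L \<longleftrightarrow> (\<forall>a\<in>set L. sqfree_mon (fst a) \<and> supp (fst a) \<inter> snd a = {}) \<and>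
     (\<forall>j < length L. \<forall>k < length L. j \<noteq> k \<longrightarrow> parts (L ! j) \<inter> parts (L ! k) = {})"
  (is "_ \<longleftrightarrow> ?A \<and> ?B")
proof
  assume D: "disjoint_supports L"
  have "parts (L ! j) \<inter> parts (L ! k) = {}" if jk: "j < length L" "k < length L" "j \<noteq> k" for j k
  proof -
    have "supp (fst (L ! j)) \<inter> supp (fst (L ! k)) = {}" "snd (L ! j) \<inter> snd (L ! k) = {}"
      "supp (fst (L ! j)) \<inter> snd (L ! k) = {}" "supp (fst (L ! k)) \<inter> snd (L ! j) = {}"
      using D jk unfolding disjoint_supports_def by meson+
    then show ?thesis unfolding parts_def by blast
  qed
  then show "?A \<and> ?B" using D by (simp add: disjoint_supports_def all_set_conv_all_nth)
next
  assume AB: "?A \<and> ?B"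
  have 1: "supp (fst (L ! j)) \<inter> supp (fst (L ! k)) = {}" "snd (L ! j) \<inter> snd (L ! k) = {}"
      "supp (fst (L ! j)) \<inter> snd (L ! k) = {}" if jk: "j < length L" "k < length L" "j \<noteq> k" for j k
  proof -
    have "parts (L ! j) \<inter> parts (L ! k) = {}" using AB jk by blast
    then show "supp (fst (L ! j)) \<inter> supp (fst (L ! k)) = {}" "snd (L ! j) \<inter> snd (L ! k) = {}"
      "supp (fst (L ! j)) \<inter> snd (L ! k) = {}" unfolding parts_def by blast+
  qed
  have 2: "supp (fst (L ! j)) \<inter> snd (L ! j) = {}" "sqfree_mon (fst (L ! j))" if "j < length L" for j
    using AB nth_mem[OF that] by blast+
  have "supp (fst (L ! j)) \<inter> snd (L ! k) = {}" if "j < length L" "k < length L" for j k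
    using 1(3)[of j k] 2(1)[of j] that by (cases "j = k") auto
  then show "disjoint_supports L" unfolding disjoint_supports_def using 1(1,2) 2(2) by simp
qed

lemma disjoint_supports_Cons:
  "disjoint_supports (a # L) \<longleftrightarrow> sqfree_mon (fst a) \<and> supp (fst a) \<inter> snd a = {} \<and>
     (\<forall>b\<in>set L. parts a \<inter> parts b = {}) \<and> disjoint_supports L"
  unfolding disjoint_supports_alt
  by (simp add: All_less_Suc2 all_set_conv_all_nth Int_commute) blast

text \<open>Squarefreeness of the displayed generators is what turns divisibility into inclusion of
  supports.\<close>

lemma sqfree_prefix_product:
  assumes "disjoint_supports L" "j < length L" "i \<in> snd (L ! j)"
  shows "sqfree_mon ((\<Sum>l\<le>j. fst (L ! l)) + X i)"
proof -
  have add: "sqfree_mon (a + b)" if "sqfree_mon a" "sqfree_mon b" "supp a \<inter> supp b = {}" for a b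
    unfolding sqfree_mon_def
  proof
    fix k
    have "expo a k = 0 \<or> expo b k = 0" using that(3) by (auto simp: in_keys_iff)
    then show "expo (a + b) k \<le> 1" using that(1,2) by (auto simp: sqfree_mon_def lookup_add)
  qed
  have supp_sum: "supp (\<Sum>l\<le>k. fst (L ! l)) = (\<Union>l\<le>k. supp (fst (L ! l)))" for k
    by (induction k) (auto simp: supp_add atMost_Suc)
  have "k < length L \<Longrightarrow> sqfree_mon (\<Sum>l\<le>k. fst (L ! l))" for k
  proof (induction k)
    case 0
    then show ?case using assms(1) by (simp add: disjoint_supports_def)
  next
    case (Suc k)
    then have "supp (fst (L ! l)) \<inter> supp (fst (L ! Suc k)) = {}" if "l \<le> k" for l
      using assms(1) that unfolding disjoint_supports_def by auto
    then have "supp (\<Sum>l\<le>k. fst (L ! l)) \<inter> supp (fst (L ! Suc k)) = {}" by (auto simp: supp_sum)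
    moreover have "sqfree_mon (fst (L ! Suc k))" using assms(1) Suc.prems by (simp add: disjoint_supports_def)
    ultimately show ?case using Suc by (simp add: add)
  qed
  then have "sqfree_mon (\<Sum>l\<le>j. fst (L ! l))" using assms(2) by simp
  moreover have "sqfree_mon (X i)" by (auto simp: sqfree_mon_def expo_X)
  moreover have "supp (fst (L ! l)) \<inter> snd (L ! j) = {}" if "l \<le> j" for l
    using assms(1,2) that by (simp add: disjoint_supports_def)
  then have "supp (\<Sum>l\<le>j. fst (L ! l)) \<inter> supp (X i) = {}" using assms(3) by (auto simp: supp_sum)
  ultimately show ?thesis by (rule add)
qed

lemma ideal_gen_nested:
  assumes L: "disjoint_supports L" and n: "\<And>m R. (m, R) \<in> set L \<Longrightarrow> supp m \<union> R \<subseteq> {..<n}"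
  shows "ideal_gen n {monom (\<Sum>l\<le>j. fst (L ! l)) * var i | j i. j < length L \<and> i \<in> snd (L ! j)}
     = (sf_ideal n (nested L) :: 'k::field mpoly set)"
proof -
  let ?G = "{(\<Sum>l\<le>j. fst (L ! l)) + X i | j i. j < length L \<and> i \<in> snd (L ! j)}"
  have Lj: "supp (fst (L ! j)) \<subseteq> {..<n}" "snd (L ! j) \<subseteq> {..<n}" if "j < length L" for j
    using n[of "fst (L ! j)" "snd (L ! j)"] that by auto
  have supp_sum: "supp (\<Sum>l\<le>k. fst (L ! l)) = (\<Union>l\<le>k. supp (fst (L ! l)))" for k
    by (induction k) (auto simp: supp_add atMost_Suc)
  have "{monom (\<Sum>l\<le>j. fst (L ! l)) * var i | j i. j < length L \<and> i \<in> snd (L ! j)}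
      = (monom ` ?G :: 'k mpoly set)"
    by (auto simp: var_def monom_mult)
  moreover have "supp g \<subseteq> {..<n}" if "g \<in> ?G" for g
  proof -
    obtain j i where g: "g = (\<Sum>l\<le>j. fst (L ! l)) + X i" "j < length L" "i \<in> snd (L ! j)"
      using \<open>g \<in> ?G\<close> by blast
    then have "supp (fst (L ! l)) \<subseteq> {..<n}" if "l \<le> j" for l using Lj(1)[of l] that by simp
    moreover have "i < n" using Lj(2)[OF g(2)] g(3) by auto
    ultimately show ?thesis unfolding g(1) supp_add supp_sum by auto
  qed
  ultimately have "ideal_gen n {monom (\<Sum>l\<le>j. fst (L ! l)) * var i | j i. j < length L \<and> i \<in> snd (L ! j)}
      = (multiples n ?G :: 'k mpoly set)"
    using ideal_gen_monoms[of ?G n] by simp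
  moreover have "(\<exists>g\<in>?G. mdvd g u) \<longleftrightarrow> nested L (supp u)" for u
    unfolding nested_iff using mdvd_sqfree_iff[OF sqfree_prefix_product[OF L]] by blast
  ultimately show ?thesis by (simp add: multiples_def sf_ideal_def)
qed

lemma decision_list_disj_set:
  assumes "finite R" "decision_list V f" "R \<inter> V = {}"
  shows "decision_list (R \<union> V) (\<lambda>A. R \<inter> A \<noteq> {} \<or> f A)"
  using assms(1,3)
proof (induction R)
  case (insert x R)
  have eq: "(\<lambda>A. insert x R \<inter> A \<noteq> {} \<or> f A) = (\<lambda>A. x \<in> A \<or> (R \<inter> A \<noteq> {} \<or> f A))" by auto
  show ?case unfolding Un_insert_left eq by (rule dl_disj) (use insert in auto)
qed (use assms in simp)

lemma decision_list_conj_set: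
  assumes "finite R" "decision_list V f" "R \<inter> V = {}"
  shows "decision_list (R \<union> V) (\<lambda>A. R \<subseteq> A \<and> f A)"
  using assms(1,3)
proof (induction R)
  case (insert x R)
  have eq: "(\<lambda>A. insert x R \<subseteq> A \<and> f A) = (\<lambda>A. x \<in> A \<and> (R \<subseteq> A \<and> f A))" by auto
  show ?case unfolding Un_insert_left eq by (rule dl_conj) (use insert in auto)
qed (use assms in simp)

text \<open>A pair \<open>(m, R)\<close> unfolds into one disjunction per variable of
  \<open>R\<close>, wrapped in one conjunction per variable of \<open>m\<close>. Variables of
  \<open>V\<close> in no pair end up in the free set of \<open>dl_zero\<close>.\<close>

lemma decision_list_nested:
  assumes "disjoint_supports L" "finite V" "\<And>m R. (m, R) \<in> set L \<Longrightarrow> supp m \<union> R \<subseteq> V"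
  shows "decision_list V (nested L)"
  using assms
proof (induction L arbitrary: V)
  case Nil
  have "nested [] = (\<lambda>_. False)" by auto
  then show ?case by (simp add: dl_zero)
next
  case (Cons mR L)
  obtain m R where mR: "mR = (m, R)" by (cases mR)
  let ?W = "V - supp m - R"
  have sub: "supp m \<subseteq> V" "R \<subseteq> V" using Cons.prems(3)[of m R] mR by auto
  have disj: "supp m \<inter> R = {}" using Cons.prems(1) mR by (simp add: disjoint_supports_Cons)
  have "supp m' \<union> R' \<subseteq> ?W" if in_L: "(m', R') \<in> set L" for m' R'
  proof -
    have "parts (m, R) \<inter> parts (m', R') = {}"
      using Cons.prems(1) in_L mR by (simp add: disjoint_supports_Cons)
    then show ?thesis using Cons.prems(3)[of m' R'] in_L by (auto simp: parts_def)
  qed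
  then have "decision_list ?W (nested L)"
    using Cons.prems(1,2) by (intro Cons.IH) (auto simp: disjoint_supports_Cons)
  then have "decision_list (R \<union> ?W) (\<lambda>A. R \<inter> A \<noteq> {} \<or> nested L A)"
    using Cons.prems(2) sub finite_subset by (intro decision_list_disj_set) auto
  then have "decision_list (supp m \<union> (R \<union> ?W)) (\<lambda>A. supp m \<subseteq> A \<and> (R \<inter> A \<noteq> {} \<or> nested L A))"
    using disj by (intro decision_list_conj_set) auto
  moreover have "supp m \<union> (R \<union> ?W) = V" using sub by auto
  moreover have "nested (mR # L) = (\<lambda>A. supp m \<subseteq> A \<and> (R \<inter> A \<noteq> {} \<or> nested L A))"
    by (rule ext) (auto simp: mR)
  ultimately show ?case by simp
qed

text \<open>Each step becomes a pair of its own: \<open>(X x, {})\<close> for multiplication by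
  \<open>x\<close> and \<open>(0, {x})\<close> for adding \<open>x\<close>, where \<open>0\<close>
  is the exponent vector of the monomial 1.\<close>

lemma decision_list_imp_nested:
  assumes "decision_list V f"
  shows "\<exists>L. disjoint_supports L \<and> (\<forall>(m, R)\<in>set L. supp m \<union> R \<subseteq> V) \<and> f = nested L"
  using assms
proof (induction rule: decision_list.induct)
  case (dl_zero V)
  show ?case by (intro exI[of _ "[]"]) (auto simp: disjoint_supports_def)
next
  case (dl_conj V f x)
  then obtain L where L: "disjoint_supports L" "\<forall>(m, R)\<in>set L. supp m \<union> R \<subseteq> V" "f = nested L" by blast
  have "sqfree_mon (X x)" by (auto simp: sqfree_mon_def expo_X)
  then show ?case using L dl_conj.hyps
    by (intro exI[of _ "(X x, {}) # L"]) (fastforce simp: disjoint_supports_Cons parts_def)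
next
  case (dl_disj V f x)
  then obtain L where L: "disjoint_supports L" "\<forall>(m, R)\<in>set L. supp m \<union> R \<subseteq> V" "f = nested L" by blast
  have "sqfree_mon 0" by (auto simp: sqfree_mon_def)
  then show ?case using L dl_disj.hyps
    by (intro exI[of _ "(0, {x}) # L"]) (fastforce simp: disjoint_supports_Cons parts_def)
qed

text \<open>The unit ideal is Gotzmann, but every displayed generator is divisible by a variable;
  hence the restriction to proper ideals. The zero ideal is given by the empty list.\<close>

theorem theorem3p9:
  fixes n :: nat and I :: "('k::field) mpoly set"
  assumes "sqfree_monomial_ideal n I"
    and "I \<noteq> polyS n"
  shows "gotzmann n I \<longleftrightarrow>
    (\<exists>L :: ((nat \<Rightarrow>\<^sub>0 nat) \<times> nat set) list.
       (\<forall>j < length L. sqfree_mon (fst (L ! j)) \<and> Poly_Mapping.keys (fst (L ! j)) \<subseteq> {..<n}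
                        \<and> snd (L ! j) \<subseteq> {..<n}) \<and>
       (\<forall>j < length L. \<forall>k < length L. j \<noteq> k \<longrightarrow>
            Poly_Mapping.keys (fst (L ! j)) \<inter> Poly_Mapping.keys (fst (L ! k)) = {} \<and> snd (L ! j) \<inter> snd (L ! k) = {}) \<and>
       (\<forall>j < length L. \<forall>k < length L. Poly_Mapping.keys (fst (L ! j)) \<inter> snd (L ! k) = {}) \<and>
       I = ideal_gen n
             {monom (\<Sum>l\<le>j. fst (L ! l)) * var i | j i. j < length L \<and> i \<in> snd (L ! j)})"
    (is "_ \<longleftrightarrow> ?R")
proof
  assume G: "gotzmann n I"
  obtain f where f: "I = sf_ideal n f" "\<And>A B. A \<subseteq> B \<Longrightarrow> f A \<Longrightarrow> f B"
    "\<And>A. f A \<longleftrightarrow> f (A \<inter> {..<n})" "\<not> f {}"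
    using sqfree_monomial_idealE[OF assms] by blast
  have "growth_minimal {..<n} f" using G f(1) gotzmann_sf_ideal by blast
  then have "decision_list {..<n} f"
    by (intro decision_list_if_growth_minimal[OF _ f(2,3,4)]) auto
  then obtain L where L: "disjoint_supports L" "\<forall>(m, R)\<in>set L. supp m \<union> R \<subseteq> {..<n}" "f = nested L"
    using decision_list_imp_nested by blast
  have eq: "I = ideal_gen n {monom (\<Sum>l\<le>j. fst (L ! l)) * var i | j i. j < length L \<and> i \<in> snd (L ! j)}"
    unfolding f(1) L(3) by (rule ideal_gen_nested[symmetric]) (use L in auto)
  have "supp (fst (L ! j)) \<subseteq> {..<n} \<and> snd (L ! j) \<subseteq> {..<n}" if "j < length L" for j
    using L(2) nth_mem[OF that] by (auto simp: split_beta)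
  then have sub: "\<forall>j<length L. sqfree_mon (fst (L ! j)) \<and> supp (fst (L ! j)) \<subseteq> {..<n} \<and> snd (L ! j) \<subseteq> {..<n}"
    using L(1) by (simp add: disjoint_supports_def)
  show ?R
    by (rule exI[of _ L], intro conjI sub eq)
      (use L(1) in \<open>simp_all add: disjoint_supports_def\<close>)
next
  assume ?R
  then obtain L where L: "disjoint_supports L"
    "\<forall>j < length L. supp (fst (L ! j)) \<subseteq> {..<n} \<and> snd (L ! j) \<subseteq> {..<n}"
    "I = ideal_gen n {monom (\<Sum>l\<le>j. fst (L ! l)) * var i | j i. j < length L \<and> i \<in> snd (L ! j)}"
    unfolding disjoint_supports_def by blast
  have sub: "supp m \<union> R \<subseteq> {..<n}" if "(m, R) \<in> set L" for m R
    using L(2) that by (auto simp: in_set_conv_nth) (metis fst_conv lessThan_iff snd_conv subsetD)+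
  have "growth_minimal {..<n} (nested L)"
    by (rule growth_minimal_decision_list[OF decision_list_nested[OF L(1) _ sub]]) auto
  moreover have "I = sf_ideal n (nested L)"
    using L(3) ideal_gen_nested[OF L(1) sub] by (rule trans)
  ultimately show "gotzmann n I" by (simp add: gotzmann_sf_ideal)
qed

end
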